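(* Let $X,X_1,X_2,\ldots$ be iid random variables with cdf $F$ having a finite non-zero mean $\mu=\mathbb{E}(X)$, let $F_n$ be the empirical cdf and $\mu_n$ the arithmetic mean of $X_1,\dots,X_n$, and let $p\in(0,1)$. Let $$\mathrm{LC}(p)=\frac{1}{\mu}\int_0^p F^{-1}(u)\,du,\qquad \mathrm{LC}_n(p)=\frac{1}{\mu_n}\int_0^p F_n^{-1}(u)\,du .$$ (1) $\mathrm{LC}_n(p)\stackrel{\mathbb{P}}{\to}\mathrm{LC}(p)$ as $n\to\infty$. (2) If in addition $\mathbb{E}(X^2)<\infty$ and the quantile function $F^{-1}$ is continuous at the point $p$, then $$\sqrt{n}\,\big(\mathrm{LC}_n(p)-\mathrm{LC}(p)\big)\stackrel{d}{\to}\mathcal{N}(0,\sigma^2(p)),$$ where $\sigma^2(p)$ is the second moment of the mean-zero random variable $$Y(p)= \frac{1}{\mu } \int_{-\infty }^{F^{-1}(p)} \big( \mathbf{1}\{X\le x\} -F(x)\big)\, dx +\frac{\mathrm{LC}(p)}{\mu } \big( X-\mu \big) .$$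
   Context: The quantile function of a cdf $F$ is $F^{-1}(u)=\inf\{x\in\mathbb{R}: F(x)\ge u\}$ for $u\in(0,1]$ and $F^{-1}(0)=\lim_{u\downarrow 0}F^{-1}(u)$. The empirical cdf is $F_n(x)=\frac1n\sum_{i=1}^n\mathbf{1}\{X_i\le x\}$, with quantile function $F_n^{-1}$ defined in the same way; $\mu_n=\frac1n\sum_{i=1}^nX_i=\int_0^1F_n^{-1}(u)\,du$ (the event $\mu_n=0$ has probability tending to $0$, so the value assigned to $\mathrm{LC}_n(p)$ on it is immaterial). $\stackrel{\mathbb{P}}{\to}$ and $\stackrel{d}{\to}$ denote convergence in probability and in distribution; $\mathcal{N}(0,\sigma^2)$ is the normal distribution (degenerate at $0$ if $\sigma^2=0$). *)

theory Defs
  imports "HOL-Probability.Probability"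
begin

(* The value is extended real because quantile F 0 may be -\<infinity> and quantile F 1 may be +\<infinity>
   (infimum of the empty set).  Only arguments u in [0,1] are meaningful. *)
definition quantile :: "(real \<Rightarrow> real) \<Rightarrow> real \<Rightarrow> ereal" where
  "quantile F u =
     (if u = 0 then Lim (at_right 0) (\<lambda>v. INF x\<in>{x. v \<le> F x}. ereal x)
      else INF x\<in>{x. u \<le> F x}. ereal x)"

(* The observations are X 1, ..., X n; X 0 is the generic copy of the random variable. *)
definition empirical_cdf :: "(nat \<Rightarrow> 'a \<Rightarrow> real) \<Rightarrow> nat \<Rightarrow> 'a \<Rightarrow> real \<Rightarrow> real" where
  "empirical_cdf X n \<omega> x = (\<Sum>i=1..n. indicat_real {..x} (X i \<omega>)) / real n"

definition sample_mean :: "(nat \<Rightarrow> 'a \<Rightarrow> real) \<Rightarrow> nat \<Rightarrow> 'a \<Rightarrow> real" where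
  "sample_mean X n \<omega> = (\<Sum>i=1..n. X i \<omega>) / real n"

(* The interval integral is over the open interval (0,p), where for 0 < p < 1 the quantile function
   of a cdf is finite, so that real_of_ereal loses nothing. *)
definition lorenz_curve :: "(real \<Rightarrow> real) \<Rightarrow> real \<Rightarrow> real \<Rightarrow> real" where
  "lorenz_curve F m p = 1 / m * (LBINT u=0..p. real_of_ereal (quantile F u))"

definition empirical_lorenz_curve ::
    "(nat \<Rightarrow> 'a \<Rightarrow> real) \<Rightarrow> real \<Rightarrow> nat \<Rightarrow> 'a \<Rightarrow> real" where
  "empirical_lorenz_curve X p n \<omega> = lorenz_curve (empirical_cdf X n \<omega>) (sample_mean X n \<omega>) p"

definition lorenz_influence ::
    "(real \<Rightarrow> real) \<Rightarrow> real \<Rightarrow> real \<Rightarrow> ('a \<Rightarrow> real) \<Rightarrow> 'a \<Rightarrow> real" where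
  "lorenz_influence F m p X \<omega> =
     1 / m * (LBINT x=-\<infinity>..quantile F p. (indicat_real {..x} (X \<omega>) - F x))
       + lorenz_curve F m p / m * (X \<omega> - m)"

(* Measurability is required explicitly: the measure of a non-measurable set is 0 by convention,
   and distr of a non-measurable map is not a probability law. *)
definition converges_in_probability ::
    "'a measure \<Rightarrow> (nat \<Rightarrow> 'a \<Rightarrow> real) \<Rightarrow> ('a \<Rightarrow> real) \<Rightarrow> bool" where
  "converges_in_probability M Z W \<longleftrightarrow>
     (\<forall>n. Z n \<in> borel_measurable M) \<and> W \<in> borel_measurable M \<and>
     (\<forall>\<epsilon>>0. (\<lambda>n. measure M {\<omega> \<in> space M. \<bar>Z n \<omega> - W \<omega>\<bar> > \<epsilon>}) \<longlonglongrightarrow> 0)"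

definition converges_in_distribution ::
    "'a measure \<Rightarrow> (nat \<Rightarrow> 'a \<Rightarrow> real) \<Rightarrow> real measure \<Rightarrow> bool" where
  "converges_in_distribution M Z N \<longleftrightarrow>
     (\<forall>n. Z n \<in> borel_measurable M) \<and> weak_conv_m (\<lambda>n. distr M borel (Z n)) N"

(* The second argument is the variance. *)
definition normal_law :: "real \<Rightarrow> real \<Rightarrow> real measure" where
  "normal_law m v =
     (if v = 0 then return borel m else density lborel (\<lambda>x. ennreal (normal_density m (sqrt v) x)))"

end

theory Submission
  imports Defs
begin

text \<open>
  The integral of the quantile function over \<open>(0, p)\<close> is the maximum over \<open>t\<close> of the concave function
  \<open>h t = p t - E (t - X)\<^sup>+\<close>, attained at the quantile \<open>q\<close>; its empirical counterpart is the maximum of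
  \<open>h\<^sub>n\<close>, where the expectation is replaced by a sample mean.  As \<open>h\<^sub>n\<close> is 1-Lipschitz and dominated
  by two linear functions, the weak law at finitely many points gives convergence of the maxima.  If
  the quantile function is continuous at \<open>p\<close>, then \<open>q\<close> is the only maximizer of \<open>h\<close>, the maximizers
  of \<open>h\<^sub>n\<close> are within \<open>\<epsilon>\<close> of \<open>q\<close> with high probability, and there the slopes of \<open>h\<^sub>n\<close> away from \<open>q\<close>
  are of order \<open>1 / sqrt n\<close>.  So \<open>max h\<^sub>n - h\<^sub>n q\<close> is negligible at the scale \<open>1 / sqrt n\<close>, and what
  remains is a sample mean of iid variables divided by \<open>\<mu>\<^sub>n\<close>, to which the central limit theorem and
  Slutsky's lemma apply.
\<close>

section \<open>The integral of the quantile function\<close>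

context cdf_distribution
begin

text \<open>By right continuity the cdf is at least \<open>u\<close> on a closed half-line with left
  end \<open>I u\<close>, the pseudoinverse of the Skorohod construction. So at levels strictly
  between 0 and 1 the extended-real infimum is attained and finite.\<close>

lemma quantile_cdf:
  assumes "0 < u" "u < 1"
  shows "quantile C u = ereal (I u)"
proof -
  have "{x. u \<le> C x} = {I u..}"
    using pseudoinverse[OF assms] by blast
  then have "quantile C u = (INF x\<in>{I u..}. ereal x)"
    using assms(1) by (metis less_irrefl quantile_def)
  also have "\<dots> = ereal (I u)"
    by (intro antisym INF_lower2[of "I u"] INF_greatest) auto
  finally show ?thesis .
qed

lemma interval_integral_quantile_cdf:
  assumes "0 < p" "p < 1"
  shows "(LBINT u=0..p. real_of_ereal (quantile C u)) = (LINT u:{0<..<p}|lborel. I u)"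
proof -
  have "einterval 0 (ereal p) = {0<..<p}"
    by (simp add: einterval_eq zero_ereal_def)
  moreover have "(LINT u:{0<..<p}|lborel. real_of_ereal (quantile C u)) = (LINT u:{0<..<p}|lborel. I u)"
    by (rule set_lebesgue_integral_cong) (use assms in \<open>auto simp: quantile_cdf\<close>)
  ultimately show ?thesis
    using assms by (simp add: interval_lebesgue_integral_def)
qed

text \<open>Under Lebesgue measure on the open unit interval \<open>I\<close> has law
  \<open>M\<close> (the quantile transform), so integrability and, in the next lemma, integrals pass
  between \<open>M\<close> and that interval.\<close>

lemma set_integrable_I:
  assumes "integrable M f" "f \<in> borel_measurable borel"
  shows "set_integrable lborel {0<..<1} (\<lambda>u. f (I u) :: real)"
proof -
  have [measurable]: "I \<in> borel_measurable (restrict_space lborel {0<..<1})"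
    using measurable_CI by (simp cong: measurable_cong_sets sets_restrict_space_cong)
  have "integrable (distr (restrict_space lborel {0<..<1}) borel I) f"
    using assms by (simp add: distr_I_eq_M)
  then show ?thesis
    using assms(2) by (simp add: integrable_distr_eq integrable_restrict_space set_integrable_def)
qed

lemma integral_eq_set_integral_I:
  assumes "f \<in> borel_measurable borel"
  shows "(\<integral>x. f x \<partial>M) = (LINT u:{0<..<1}|lborel. f (I u) :: real)"
proof -
  have [measurable]: "I \<in> borel_measurable (restrict_space lborel {0<..<1})"
    using measurable_CI by (simp cong: measurable_cong_sets sets_restrict_space_cong)
  have "(\<integral>x. f x \<partial>M) = (\<integral>x. f x \<partial>distr (restrict_space lborel {0<..<1}) borel I)"
    by (simp add: distr_I_eq_M)
  then show ?thesis
    using assms by (simp add: integral_distr integral_restrict_space set_lebesgue_integral_def)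
qed

text \<open>The partial integral of the quantile function is the Legendre transform
  \<open>p \<mapsto> sup\<^sub>t (p t - \<integral>(t - x)\<^sup>+ dM)\<close>, and the supremum is attained at the quantile.\<close>

lemma
  assumes int: "integrable M (\<lambda>x. x)" and p: "0 < p" "p < 1"
  shows quantile_integral_ge:
      "p * t - (\<integral>x. max 0 (t - x) \<partial>M) \<le> (LBINT u=0..p. real_of_ereal (quantile C u))"
    and quantile_integral_eq:
      "(LBINT u=0..p. real_of_ereal (quantile C u)) = p * I p - (\<integral>x. max 0 (I p - x) \<partial>M)"
proof -
  have intI: "set_integrable lborel {0<..<1} I"
    using set_integrable_I[OF int] by simp
  have intIp: "set_integrable lborel {0<..<p} I"
    by (rule set_integrable_subset[OF intI]) (use p in auto)
  have intmax: "set_integrable lborel {0<..<1} (\<lambda>u. max 0 (t - I u))" for t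
  proof (rule set_integrable_I)
    show "integrable M (\<lambda>x. max 0 (t - x))"
      using int by (intro integrable_max) auto
  qed simp
  have eq: "(\<integral>x. max 0 (t - x) \<partial>M) = (LINT u:{0<..<1}|lborel. max 0 (t - I u))" for t
    by (rule integral_eq_set_integral_I) simp
  have const: "set_integrable lborel {0<..<p} (\<lambda>u. t)" for t :: real
    using p by (simp add: set_integrable_def)
  have lin: "(LINT u:{0<..<p}|lborel. t - I u) = p * t - (LINT u:{0<..<p}|lborel. I u)" for t
    using p by (subst set_integral_diff(2)[OF const intIp]) (simp add: set_lebesgue_integral_def)
  \<comment> \<open>Pointwise, \<open>t - I u\<close> on \<open>{0<..<p}\<close> is at most its
    positive part on all of \<open>{0<..<1}\<close>.\<close>
  have "(LINT u:{0<..<p}|lborel. t - I u) \<le> (LINT u:{0<..<1}|lborel. max 0 (t - I u))"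
    unfolding set_lebesgue_integral_def
    by (rule integral_mono)
      (use set_integral_diff(1)[OF const intIp, of t] intmax[of t] p in
       \<open>auto simp: set_integrable_def split: split_indicator\<close>)
  then show "p * t - (\<integral>x. max 0 (t - x) \<partial>M) \<le> (LBINT u=0..p. real_of_ereal (quantile C u))"
    using lin[of t] eq[of t] interval_integral_quantile_cdf[OF p] by simp
  \<comment> \<open>For \<open>t = I p\<close> the integrands agree: by monotonicity
    \<open>I p - I u\<close> is nonnegative below \<open>p\<close> and nonpositive above.\<close>
  have "(LINT u:{0<..<1}|lborel. max 0 (I p - I u)) = (LINT u:{0<..<p}|lborel. I p - I u)"
    unfolding set_lebesgue_integral_def
  proof (rule Bochner_Integration.integral_cong[OF refl])
    fix u
    have "I u \<le> I p" if "0 < u" "u \<le> p"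
      using mono_I that p by (auto simp: mono_on_def)
    moreover have "I p \<le> I u" if "p \<le> u" "u < 1"
      using mono_I that p by (auto simp: mono_on_def)
    ultimately show "indicat_real {0<..<1} u *\<^sub>R max 0 (I p - I u) = indicat_real {0<..<p} u *\<^sub>R (I p - I u)"
      using p by (cases "u < p") (auto split: split_indicator)
  qed
  then show "(LBINT u=0..p. real_of_ereal (quantile C u)) = p * I p - (\<integral>x. max 0 (I p - x) \<partial>M)"
    using lin[of "I p"] eq[of "I p"] interval_integral_quantile_cdf[OF p] by simp
qed

text \<open>The mass of the open half-line is the left limit of the cdf, and the cdf is below
  \<open>p\<close> left of the quantile. Together with \<open>p \<le> C (I p)\<close> this puts
  \<open>p\<close> between the weights of the open and the closed half-line.\<close>

lemma measure_lessThan_quantile_le: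
  assumes p: "0 < p" "p < 1"
  shows "measure M {..<I p} \<le> p"
proof (rule tendsto_upperbound[OF cdf_at_left])
  show "\<forall>\<^sub>F x in at_left (I p). C x \<le> p"
    unfolding eventually_at_filter
  proof (intro always_eventually allI impI)
    fix x assume "x \<in> {..<I p}"
    then show "C x \<le> p" using pseudoinverse[OF p, of x] by auto
  qed
qed simp

text \<open>A flat piece of the cdf at height \<open>p\<close> would make the quantile function jump
  at \<open>p\<close>. Its absence makes \<open>I p\<close> the only maximizer of the concave
  objective.\<close>

lemma cdf_greater_if_quantile_continuous:
  assumes p: "0 < p" "p < 1" and cont: "isCont (quantile C) p" and x: "I p < x"
  shows "p < C x"
proof (rule ccontr)
  assume "\<not> p < C x"
  have "(quantile C \<longlongrightarrow> quantile C p) (at_right p)"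
    using cont by (simp add: isCont_def filterlim_at_split)
  then have "\<forall>\<^sub>F u in at_right p. quantile C u < ereal x"
    using x p by (intro order_tendstoD(2)) (auto simp: quantile_cdf)
  moreover have "\<forall>\<^sub>F u in at_right p. u \<in> {p<..<1}"
    using p by (intro eventually_at_right_real) 
  \<comment> \<open>A level \<open>u\<close> slightly above \<open>p\<close> has quantile below
    \<open>x\<close>, hence \<open>u \<le> C x \<le> p\<close>, which is absurd.\<close>
  ultimately have "\<forall>\<^sub>F u in at_right p. False"
  proof eventually_elim
    case (elim u)
    then have "I u < x" using p by (simp add: quantile_cdf)
    then have "u \<le> C x" using pseudoinverse[of u x] p elim by auto
    then show False using elim \<open>\<not> p < C x\<close> by auto
  qed
  then show False by simp
qed

text \<open>Integrating the indicator of \<open>y \<le> x\<close> over \<open>x < q\<close> gives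
  the shortfall \<open>max 0 (q - y)\<close>, and averaging over \<open>y\<close> turns the
  indicator into the cdf. This identifies the integral in the influence function as a centred
  shortfall.\<close>

lemma interval_integral_indicator_minus_cdf:
  assumes int: "integrable M (\<lambda>x. x)"
  shows "(LBINT x=-\<infinity>..ereal q. (indicat_real {..x} y - C x)) = max 0 (q - y) - (\<integral>x. max 0 (q - x) \<partial>M)"
proof -
  have 1: "has_bochner_integral lborel (\<lambda>x. indicat_real {..<q} x * indicat_real {..x} y) (max 0 (q - y))" for y
  proof (rule has_bochner_integral_nn_integral)
    have "(\<integral>\<^sup>+x. ennreal (indicat_real {..<q} x * indicat_real {..x} y) \<partial>lborel)
        = (\<integral>\<^sup>+x. indicator {y..<q} x \<partial>lborel)"
      by (intro nn_integral_cong) (auto split: split_indicator)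
    then show "(\<integral>\<^sup>+x. ennreal (indicat_real {..<q} x * indicat_real {..x} y) \<partial>lborel) = ennreal (max 0 (q - y))"
      by (cases "y \<le> q") (auto simp: max_def)
  qed (auto simp: indicator_def)
  interpret P: pair_sigma_finite lborel M
    by (simp add: pair_sigma_finite_def sigma_finite_lborel sigma_finite_measure_axioms)
  \<comment> \<open>Tonelli's theorem: \<open>C x\<close> is the mean of the indicator over
    \<open>y\<close>, so the integral of \<open>C\<close> below \<open>q\<close> is the mean of the
    integrals computed in the first fact. Both terms are thus integrable separately.\<close>
  have 2: "has_bochner_integral lborel (\<lambda>x. indicat_real {..<q} x * C x) (\<integral>x. max 0 (q - x) \<partial>M)"
  proof (rule has_bochner_integral_nn_integral)
    have C: "ennreal (C x) = (\<integral>\<^sup>+y. indicator {..x} y \<partial>M)" for x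
      by (simp add: cdf_def emeasure_eq_measure)
    have "(\<integral>\<^sup>+x. ennreal (indicat_real {..<q} x * C x) \<partial>lborel)
        = (\<integral>\<^sup>+x. (\<integral>\<^sup>+y. ennreal (indicat_real {..<q} x * indicat_real {..x} y) \<partial>M) \<partial>lborel)"
      by (intro nn_integral_cong) (auto simp: C ennreal_indicator indicator_def[of "{..<q}"])
    also have "\<dots> = (\<integral>\<^sup>+y. (\<integral>\<^sup>+x. ennreal (indicat_real {..<q} x * indicat_real {..x} y) \<partial>lborel) \<partial>M)"
    proof (rule P.Fubini'[symmetric])
      have "(\<lambda>(x, y). indicat_real {..<q} x * (if y \<le> x then 1 else 0)) \<in> borel_measurable (lborel \<Otimes>\<^sub>M (borel :: real measure))"
        by measurable
      then show "(\<lambda>(x, y). ennreal (indicat_real {..<q} x * indicat_real {..x} y)) \<in> borel_measurable (lborel \<Otimes>\<^sub>M M)"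
        by (simp add: indicator_def case_prod_unfold cong: measurable_cong_sets sets_pair_measure_cong)
    qed
    also have "\<dots> = (\<integral>\<^sup>+y. ennreal (max 0 (q - y)) \<partial>M)"
      using 1 by (intro nn_integral_cong)
        (subst nn_integral_eq_integral, auto simp: has_bochner_integral_iff)
    also have "\<dots> = ennreal (\<integral>x. max 0 (q - x) \<partial>M)"
      by (rule nn_integral_eq_integral) (use int in \<open>auto intro!: integrable_max\<close>)
    finally show "(\<integral>\<^sup>+x. ennreal (indicat_real {..<q} x * C x) \<partial>lborel) = ennreal (\<integral>x. max 0 (q - x) \<partial>M)" .
  qed (auto simp: cdf_nonneg intro!: integral_nonneg)
  have "einterval (-\<infinity>) (ereal q) = {..<q}"
    by (auto simp: einterval_def)
  then have "(LBINT x=-\<infinity>..ereal q. (indicat_real {..x} y - C x))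
      = (\<integral>x. indicat_real {..<q} x * indicat_real {..x} y - indicat_real {..<q} x * C x \<partial>lborel)"
    by (simp add: interval_lebesgue_integral_def set_lebesgue_integral_def right_diff_distrib)
  also have "\<dots> = max 0 (q - y) - (\<integral>x. max 0 (q - x) \<partial>M)"
    using has_bochner_integral_diff[OF 1 2] by (rule has_bochner_integral_integral_eq)
  finally show ?thesis .
qed

end

section \<open>The empirical distribution for a fixed outcome\<close>

text \<open>With the outcome frozen, this is the law of an observation whose index is drawn
  uniformly from \<open>{1..n}\<close>. It makes the results on \<open>cdf_distribution\<close>
  applicable to samples.\<close>

definition empirical_measure :: "(nat \<Rightarrow> 'a \<Rightarrow> real) \<Rightarrow> nat \<Rightarrow> 'a \<Rightarrow> real measure" where
  "empirical_measure X n \<omega> = distr (measure_pmf (pmf_of_set {1..n})) borel (\<lambda>i. X i \<omega>)"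

lemma cdf_distribution_empirical_measure: "cdf_distribution (empirical_measure X n \<omega>)"
  unfolding empirical_measure_def
  by (intro cdf_distribution.intro prob_space.real_distribution_distr prob_space_measure_pmf) simp

lemma
  fixes f :: "real \<Rightarrow> real"
  assumes "n > 0" and f: "f \<in> borel_measurable borel"
  shows integrable_empirical_measure: "integrable (empirical_measure X n \<omega>) f"
    and integral_empirical_measure:
      "(\<integral>x. f x \<partial>empirical_measure X n \<omega>) = sample_mean (\<lambda>i \<omega>. f (X i \<omega>)) n \<omega>"
proof -
  have fin: "finite {1..n}" "{1..n} \<noteq> {}"
    using \<open>n > 0\<close> by auto
  show "integrable (empirical_measure X n \<omega>) f"
    unfolding empirical_measure_def using f
    by (subst integrable_distr_eq) (use fin in \<open>auto intro!: integrable_measure_pmf_finite\<close>)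
  show "(\<integral>x. f x \<partial>empirical_measure X n \<omega>) = sample_mean (\<lambda>i \<omega>. f (X i \<omega>)) n \<omega>"
    unfolding empirical_measure_def using f
    by (subst integral_distr) (use fin in \<open>auto simp: integral_pmf_of_set sample_mean_def\<close>)
qed

lemma empirical_cdf_eq_cdf:
  assumes "n > 0"
  shows "empirical_cdf X n \<omega> = cdf (empirical_measure X n \<omega>)"
proof
  interpret E: cdf_distribution "empirical_measure X n \<omega>"
    by (rule cdf_distribution_empirical_measure)
  fix x
  have "cdf (empirical_measure X n \<omega>) x = (\<integral>y. indicat_real {..x} y \<partial>empirical_measure X n \<omega>)"
    unfolding cdf_def Bochner_Integration.integral_indicator E.space_eq_univ Int_UNIV_right ..
  also have "\<dots> = empirical_cdf X n \<omega> x"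
    by (subst integral_empirical_measure[OF assms]) (simp_all add: empirical_cdf_def sample_mean_def)
  finally show "empirical_cdf X n \<omega> x = cdf (empirical_measure X n \<omega>) x" ..
qed

text \<open>The Legendre representation applied to the empirical measure. The maximizer, an
  empirical quantile, stays behind an existential quantifier, since later arguments only compare
  values of the objective.\<close>

lemma
  fixes X :: "nat \<Rightarrow> 'a \<Rightarrow> real"
  assumes n: "n > 0" and p: "0 < p" "p < 1"
  shows empirical_quantile_integral_ge:
    "p * t - sample_mean (\<lambda>i \<omega>. max 0 (t - X i \<omega>)) n \<omega>
      \<le> (LBINT u=0..p. real_of_ereal (quantile (empirical_cdf X n \<omega>) u))"
    and empirical_quantile_integral_eq:
    "\<exists>t. (LBINT u=0..p. real_of_ereal (quantile (empirical_cdf X n \<omega>) u))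
      = p * t - sample_mean (\<lambda>i \<omega>. max 0 (t - X i \<omega>)) n \<omega>"
proof -
  interpret E: cdf_distribution "empirical_measure X n \<omega>"
    by (rule cdf_distribution_empirical_measure)
  have int: "integrable (empirical_measure X n \<omega>) (\<lambda>x. x)"
    by (rule integrable_empirical_measure[OF n]) simp
  have mean: "(\<integral>x. max 0 (t - x) \<partial>empirical_measure X n \<omega>) = sample_mean (\<lambda>i \<omega>. max 0 (t - X i \<omega>)) n \<omega>" for t
    by (rule integral_empirical_measure[OF n]) simp
  show "p * t - sample_mean (\<lambda>i \<omega>. max 0 (t - X i \<omega>)) n \<omega>
      \<le> (LBINT u=0..p. real_of_ereal (quantile (empirical_cdf X n \<omega>) u))"
    using E.quantile_integral_ge[OF int p, of t] unfolding mean empirical_cdf_eq_cdf[OF n] .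
  show "\<exists>t. (LBINT u=0..p. real_of_ereal (quantile (empirical_cdf X n \<omega>) u))
      = p * t - sample_mean (\<lambda>i \<omega>. max 0 (t - X i \<omega>)) n \<omega>"
    using E.quantile_integral_eq[OF int p] unfolding mean empirical_cdf_eq_cdf[OF n] by (intro exI[of _ "E.I p"])
qed

section \<open>Convergence in probability and iid sequences\<close>

context prob_space
begin

text \<open>The filter of statements about the index \<open>n\<close> and the outcome \<open>\<omega>\<close> that hold with probability
  tending to \<open>1\<close>: convergence along it is convergence in probability.\<close>

definition whp :: "(nat \<times> 'a) filter" where
  "whp = Abs_filter (\<lambda>P. \<exists>A. (\<forall>n. A n \<in> events) \<and> (\<lambda>n. prob (A n)) \<longlonglongrightarrow> 0 \<and>
     (\<forall>n. \<forall>\<omega>\<in>space M - A n. P (n, \<omega>)))"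

text \<open>Unions of two exceptional sequences are again exceptional, which gives the filter
  axioms. The exceptional sets are measurable events because the sets where \<open>P\<close> fails
  may not be.\<close>

lemma eventually_whp:
  "eventually P whp \<longleftrightarrow> (\<exists>A. (\<forall>n. A n \<in> events) \<and> (\<lambda>n. prob (A n)) \<longlonglongrightarrow> 0 \<and>
     (\<forall>n. \<forall>\<omega>\<in>space M - A n. P (n, \<omega>)))"
  unfolding whp_def
proof (rule eventually_Abs_filter, rule is_filter.intro, goal_cases)
  case 1
  show ?case by (rule exI[of _ "\<lambda>_. {}"]) simp
next
  case (2 P Q)
  then obtain A B where A: "\<forall>n. A n \<in> events" "(\<lambda>n. prob (A n)) \<longlonglongrightarrow> 0" "\<forall>n. \<forall>\<omega>\<in>space M - A n. P (n, \<omega>)"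
    and B: "\<forall>n. B n \<in> events" "(\<lambda>n. prob (B n)) \<longlonglongrightarrow> 0" "\<forall>n. \<forall>\<omega>\<in>space M - B n. Q (n, \<omega>)"
    by blast
  have "(\<lambda>n. prob (A n \<union> B n)) \<longlonglongrightarrow> 0"
  proof (rule tendsto_sandwich[OF _ _ tendsto_const])
    show "(\<lambda>n. prob (A n) + prob (B n)) \<longlonglongrightarrow> 0"
      using tendsto_add[OF A(2) B(2)] by simp
  qed (use A(1) B(1) in \<open>auto intro!: always_eventually measure_Un_le\<close>)
  with A B show ?case
    by (intro exI[of _ "\<lambda>n. A n \<union> B n"]) auto
next
  case (3 P Q)
  then show ?case by blast
qed

lemma eventually_whp_sequentially:
  assumes "eventually P sequentially"
  shows "\<forall>\<^sub>F (n, \<omega>) in whp. P n"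
  unfolding eventually_whp
proof (intro exI conjI allI ballI)
  show "(\<lambda>n. prob (if P n then {} else space M)) \<longlonglongrightarrow> 0"
    by (rule tendsto_eventually, rule eventually_mono[OF assms]) auto
qed (auto split: if_splits)

lemma tendsto_whp_iff:
  fixes Z :: "nat \<Rightarrow> 'a \<Rightarrow> real"
  assumes [measurable]: "\<And>n. Z n \<in> borel_measurable M"
  shows "((\<lambda>(n, \<omega>). Z n \<omega>) \<longlongrightarrow> c) whp \<longleftrightarrow>
    (\<forall>\<epsilon>>0. (\<lambda>n. prob {\<omega> \<in> space M. \<bar>Z n \<omega> - c\<bar> > \<epsilon>}) \<longlonglongrightarrow> 0)"
proof safe
  fix \<epsilon> :: real
  assume lim: "((\<lambda>(n, \<omega>). Z n \<omega>) \<longlongrightarrow> c) whp" and "\<epsilon> > 0"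
  from tendstoD[OF this] obtain A where A: "\<forall>n. A n \<in> events" "(\<lambda>n. prob (A n)) \<longlonglongrightarrow> 0"
      "\<forall>n. \<forall>\<omega>\<in>space M - A n. dist (Z n \<omega>) c < \<epsilon>"
    unfolding eventually_whp by auto
  have "prob {\<omega> \<in> space M. \<bar>Z n \<omega> - c\<bar> > \<epsilon>} \<le> prob (A n)" for n
    by (rule finite_measure_mono) (use A(1,3) in \<open>force simp: dist_real_def\<close>)+
  then show "(\<lambda>n. prob {\<omega> \<in> space M. \<bar>Z n \<omega> - c\<bar> > \<epsilon>}) \<longlonglongrightarrow> 0"
    by (intro tendsto_sandwich[OF _ _ tendsto_const A(2)]) (auto intro!: always_eventually)
next
  assume *: "\<forall>\<epsilon>>0. (\<lambda>n. prob {\<omega> \<in> space M. \<bar>Z n \<omega> - c\<bar> > \<epsilon>}) \<longlonglongrightarrow> 0"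
  show "((\<lambda>(n, \<omega>). Z n \<omega>) \<longlongrightarrow> c) whp"
  proof (rule tendstoI)
    fix e :: real assume "e > 0"
    then show "\<forall>\<^sub>F x in whp. dist (case x of (n, \<omega>) \<Rightarrow> Z n \<omega>) c < e"
      \<comment> \<open>Halving \<open>e\<close> turns the non-strict bound off the exceptional set
        into the strict one required.\<close>
      unfolding eventually_whp using *[rule_format, of "e/2"]
      by (intro exI[of _ "\<lambda>n. {\<omega> \<in> space M. \<bar>Z n \<omega> - c\<bar> > e/2}"]) (auto simp: dist_real_def)
  qed
qed

text \<open>Slutsky's lemma for characteristic functions: two exponentials differ by at most
  \<open>\<bar>t\<bar>\<close> times the distance of \<open>V\<close> and \<open>W\<close> where
  these are close, and by at most 2 on the event of vanishing probability where they are
  not.\<close>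

lemma char_diff_tendsto_0:
  assumes [measurable]: "\<And>n. V n \<in> borel_measurable M" "\<And>n. W n \<in> borel_measurable M"
    and lim: "((\<lambda>(n, \<omega>). V n \<omega> - W n \<omega>) \<longlongrightarrow> 0) whp"
  shows "(\<lambda>n. char (distr M borel (V n)) t - char (distr M borel (W n)) t) \<longlonglongrightarrow> 0"
proof (rule tendstoI)
  fix e :: real assume "e > 0"
  \<comment> \<open>The summand 1 covers \<open>t = 0\<close>. Half of \<open>e\<close> pays for the
    outcomes where the variables are close, the other half for the event \<open>B n\<close> of
    probability below \<open>e / 4\<close>.\<close>
  define \<epsilon> where "\<epsilon> = e / (2 * (\<bar>t\<bar> + 1))"
  have \<epsilon>: "\<epsilon> > 0" "\<bar>t\<bar> * \<epsilon> < e / 2"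
    using \<open>e > 0\<close> by (auto simp: \<epsilon>_def field_simps)
  define B where "B n = {\<omega> \<in> space M. \<bar>V n \<omega> - W n \<omega>\<bar> > \<epsilon>}" for n
  have [measurable]: "B n \<in> events" for n
    by (simp add: B_def)
  have "(\<lambda>n. prob (B n)) \<longlonglongrightarrow> 0"
    using lim \<epsilon>(1) by (subst (asm) tendsto_whp_iff) (auto simp: B_def)
  then have "\<forall>\<^sub>F n in sequentially. prob (B n) < e / 4"
    using \<open>e > 0\<close> by (intro order_tendstoD(2)) auto
  then show "\<forall>\<^sub>F n in sequentially.
      dist (char (distr M borel (V n)) t - char (distr M borel (W n)) t) 0 < e"
  proof eventually_elim
    case (elim n)
    have int: "integrable M (\<lambda>\<omega>. iexp (t * V n \<omega>))" "integrable M (\<lambda>\<omega>. iexp (t * W n \<omega>))"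
      by (auto intro!: integrable_iexp)
    have bound: "norm (iexp (t * V n \<omega>) - iexp (t * W n \<omega>)) \<le> \<bar>t\<bar> * \<epsilon> + 2 * indicat_real (B n) \<omega>"
      if "\<omega> \<in> space M" for \<omega>
    proof (cases "\<omega> \<in> B n")
      case True
      have "norm (iexp (t * V n \<omega>) - iexp (t * W n \<omega>)) \<le> norm (iexp (t * V n \<omega>)) + norm (iexp (t * W n \<omega>))"
        by (rule norm_triangle_ineq4)
      then show ?thesis using True \<epsilon>(1) by (simp add: add_increasing)
    next
      case False
      let ?x = "t * (V n \<omega> - W n \<omega>)"
      have "iexp (t * V n \<omega>) - iexp (t * W n \<omega>) = iexp (t * W n \<omega>) * (iexp ?x - 1)"
        by (simp add: algebra_simps flip: exp_add)
      then have "norm (iexp (t * V n \<omega>) - iexp (t * W n \<omega>)) = norm (iexp ?x - 1)"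
        by (simp add: norm_mult)
      also have "\<dots> \<le> \<bar>?x\<bar>"
        using iexp_approx1[of ?x 0] by simp
      also have "\<dots> \<le> \<bar>t\<bar> * \<epsilon>"
        using False that by (auto simp: B_def abs_mult intro!: mult_left_mono)
      finally show ?thesis using False by simp
    qed
    have "norm (char (distr M borel (V n)) t - char (distr M borel (W n)) t)
        = norm (\<integral>\<omega>. iexp (t * V n \<omega>) - iexp (t * W n \<omega>) \<partial>M)"
      using int by (simp add: char_def integral_distr)
    also have "\<dots> \<le> (\<integral>\<omega>. \<bar>t\<bar> * \<epsilon> + 2 * indicat_real (B n) \<omega> \<partial>M)"
      by (rule order_trans[OF integral_norm_bound integral_mono]) (use int bound in \<open>auto simp: less_top[symmetric]\<close>)
    also have "\<dots> = \<bar>t\<bar> * \<epsilon> + 2 * prob (B n)"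
      by (simp add: prob_space less_top[symmetric])
    finally show ?case
      using elim \<epsilon>(2) by simp
  qed
qed

end

text \<open>The stochastic order symbol \<open>O\<^sub>P(1)\<close>.\<close>

definition (in prob_space) bounded_in_prob :: "(nat \<Rightarrow> 'a \<Rightarrow> real) \<Rightarrow> bool" where
  "bounded_in_prob B \<longleftrightarrow> (\<forall>\<eta>>0. \<exists>K>0. \<forall>n. prob {\<omega> \<in> space M. \<bar>B n \<omega>\<bar> \<ge> K} \<le> \<eta>)"

context prob_space
begin

lemma bounded_in_probE:
  assumes "bounded_in_prob B" "\<eta> > 0"
  obtains K where "K > 0" "\<And>n. prob {\<omega> \<in> space M. \<bar>B n \<omega>\<bar> \<ge> K} \<le> \<eta>"
  using assms unfolding bounded_in_prob_def by blast

lemma bounded_in_prob_add_abs: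
  assumes [measurable]: "\<And>n. A n \<in> borel_measurable M" "\<And>n. B n \<in> borel_measurable M"
    and "bounded_in_prob A" "bounded_in_prob B"
  shows "bounded_in_prob (\<lambda>n \<omega>. \<bar>A n \<omega>\<bar> + \<bar>B n \<omega>\<bar>)"
  unfolding bounded_in_prob_def
proof (intro allI impI)
  fix \<eta> :: real assume "\<eta> > 0"
  then have "\<eta> / 2 > 0" by simp
  from bounded_in_probE[OF assms(3) this] obtain K
    where K: "K > 0" "\<And>n. prob {\<omega> \<in> space M. \<bar>A n \<omega>\<bar> \<ge> K} \<le> \<eta> / 2" by blast
  from bounded_in_probE[OF assms(4) \<open>\<eta> / 2 > 0\<close>] obtain L
    where L: "L > 0" "\<And>n. prob {\<omega> \<in> space M. \<bar>B n \<omega>\<bar> \<ge> L} \<le> \<eta> / 2" by blast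
  have "prob {\<omega> \<in> space M. K + L \<le> \<bar>\<bar>A n \<omega>\<bar> + \<bar>B n \<omega>\<bar>\<bar>} \<le> \<eta>" for n
  proof -
    have "prob {\<omega> \<in> space M. K + L \<le> \<bar>\<bar>A n \<omega>\<bar> + \<bar>B n \<omega>\<bar>\<bar>}
        \<le> prob ({\<omega> \<in> space M. \<bar>A n \<omega>\<bar> \<ge> K} \<union> {\<omega> \<in> space M. \<bar>B n \<omega>\<bar> \<ge> L})"
      by (intro finite_measure_mono) auto
    also have "\<dots> \<le> prob {\<omega> \<in> space M. \<bar>A n \<omega>\<bar> \<ge> K} + prob {\<omega> \<in> space M. \<bar>B n \<omega>\<bar> \<ge> L}"
      by (intro measure_Un_le) auto
    also have "\<dots> \<le> \<eta>" using K(2)[of n] L(2)[of n] by simp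
    finally show ?thesis .
  qed
  with K L show "\<exists>K>0. \<forall>n. prob {\<omega> \<in> space M. K \<le> \<bar>\<bar>A n \<omega>\<bar> + \<bar>B n \<omega>\<bar>\<bar>} \<le> \<eta>"
    by (intro exI[of _ "K + L"]) auto
qed

text \<open>The rule that a vanishing factor times a sequence bounded in probability vanishes in
  probability, stated with inequalities so that no quotient \<open>A / B\<close> has to be
  formed.\<close>

lemma tendsto_whp_0_if_small_times_bounded:
  fixes A B :: "nat \<Rightarrow> 'a \<Rightarrow> real"
  assumes [measurable]: "\<And>n. A n \<in> borel_measurable M" "\<And>n. B n \<in> borel_measurable M"
    and B: "bounded_in_prob B"
    and small: "\<And>\<epsilon>. \<epsilon> > 0 \<Longrightarrow> \<forall>\<^sub>F (n, \<omega>) in whp. \<bar>A n \<omega>\<bar> \<le> \<epsilon> * \<bar>B n \<omega>\<bar>"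
  shows "((\<lambda>(n, \<omega>). A n \<omega>) \<longlongrightarrow> 0) whp"
proof (subst tendsto_whp_iff, measurable, intro allI impI tendstoI)
  fix e \<eta> :: real assume "e > 0" "\<eta> > 0"
  from \<open>\<eta> > 0\<close> have "\<eta> / 2 > 0" by simp
  from bounded_in_probE[OF B this] obtain K
    where K: "K > 0" "\<And>n. prob {\<omega> \<in> space M. \<bar>B n \<omega>\<bar> \<ge> K} \<le> \<eta> / 2" by blast
  \<comment> \<open>The ratio \<open>e / K\<close> is chosen so that, off \<open>E n\<close>, the
    deviation \<open>\<bar>A n \<omega>\<bar> > e\<close> forces
    \<open>\<bar>B n \<omega>\<bar> > K\<close>.\<close>
  obtain E where E: "\<forall>n. E n \<in> events" "(\<lambda>n. prob (E n)) \<longlonglongrightarrow> 0"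
      "\<forall>n. \<forall>\<omega>\<in>space M - E n. \<bar>A n \<omega>\<bar> \<le> e / K * \<bar>B n \<omega>\<bar>"
    using small[of "e / K"] \<open>e > 0\<close> K(1) unfolding eventually_whp by auto
  have "\<forall>\<^sub>F n in sequentially. prob (E n) < \<eta> / 2"
    using E(2) \<open>\<eta> > 0\<close> by (intro order_tendstoD(2)) auto
  then show "\<forall>\<^sub>F n in sequentially. dist (prob {\<omega> \<in> space M. e < \<bar>A n \<omega> - 0\<bar>}) 0 < \<eta>"
  proof eventually_elim
    case (elim n)
    have "\<bar>B n \<omega>\<bar> \<ge> K" if "\<omega> \<in> space M" "\<omega> \<notin> E n" "e < \<bar>A n \<omega>\<bar>" for \<omega>
    proof -
      have "e < e / K * \<bar>B n \<omega>\<bar>"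
        using that E(3) by (meson DiffI less_le_trans)
      then have "K < \<bar>B n \<omega>\<bar>"
        using \<open>e > 0\<close> K(1) by (simp add: field_simps)
      then show ?thesis by simp
    qed
    then have "prob {\<omega> \<in> space M. e < \<bar>A n \<omega>\<bar>} \<le> prob (E n \<union> {\<omega> \<in> space M. \<bar>B n \<omega>\<bar> \<ge> K})"
      by (intro finite_measure_mono) (use E(1) in auto)
    also have "\<dots> \<le> prob (E n) + prob {\<omega> \<in> space M. \<bar>B n \<omega>\<bar> \<ge> K}"
      by (intro measure_Un_le) (use E(1) in auto)
    finally show ?case
      using elim K(2)[of n] by simp
  qed
qed

lemma char_distr_cmult:
  assumes [measurable]: "V \<in> borel_measurable M"
  shows "char (distr M borel (\<lambda>\<omega>. c * V \<omega>)) t = char (distr M borel V) (c * t)"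
  by (simp add: char_def integral_distr mult_ac)

end

section \<open>The centred normal law and its characteristic function\<close>

lemma
  assumes "v \<ge> 0"
  shows real_distribution_normal_law: "real_distribution (normal_law 0 v)"
    and char_normal_law: "char (normal_law 0 v) t = exp (- (v * t\<^sup>2) / 2)"
proof -
  interpret N: real_distribution std_normal_distribution
    by (rule real_dist_normal_dist)
  have "real_distribution (normal_law 0 v) \<and> char (normal_law 0 v) t = exp (- (v * t\<^sup>2) / 2)"
  proof (cases "v = 0")
    case True
    then show ?thesis
      by (simp add: normal_law_def char_def integral_return real_distribution_def
          real_distribution_axioms_def prob_space_return)
  next
    case False
    then have v: "sqrt v > 0" using assms by simp
    \<comment> \<open>For positive variance the law is the image of the standard normal law under
      multiplication by \<open>sqrt v\<close>, which rescales the argument of the characteristic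
      function.\<close>
    have "distributed std_normal_distribution lborel (\<lambda>x. x) (normal_density 0 1)"
      unfolding distributed_def by (auto simp: distr_id2)
    from N.normal_density_affine[OF this, of "sqrt v" 0] v
    have "distributed std_normal_distribution lborel (\<lambda>x. sqrt v * x) (normal_density 0 (sqrt v))"
      by simp
    then have "distr std_normal_distribution lborel (\<lambda>x. sqrt v * x) = normal_law 0 v"
      using False by (simp add: distributed_def normal_law_def)
    then have eq: "normal_law 0 v = distr std_normal_distribution borel (\<lambda>x. sqrt v * x)"
      by (metis distr_cong sets_lborel)
    have "char (normal_law 0 v) t = char (distr std_normal_distribution borel (\<lambda>x. x)) (sqrt v * t)"
      unfolding eq by (rule N.char_distr_cmult) simp
    also have "distr std_normal_distribution borel (\<lambda>x. x) = std_normal_distribution"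
      by (rule distr_id2) simp
    finally show ?thesis
      using assms by (simp add: eq char_std_normal_distribution power_mult_distrib)
  qed
  then show "real_distribution (normal_law 0 v)" "char (normal_law 0 v) t = exp (- (v * t\<^sup>2) / 2)"
    by auto
qed

section \<open>Weak law and central limit theorem for iid sequences\<close>

locale iid_sequence = prob_space M for M :: "'a measure" +
  fixes X :: "nat \<Rightarrow> 'a \<Rightarrow> real"
  assumes indep: "indep_vars (\<lambda>_. borel) X UNIV"
    and distr_eq: "distr M borel (X n) = distr M borel (X 0)"
begin

lemma measurable_X [measurable]: "X n \<in> borel_measurable M"
  using indep by (simp add: indep_vars_def)

lemma measurable_sample_mean [measurable]: "sample_mean X n \<in> borel_measurable M"
  unfolding sample_mean_def by measurable

lemma iid_sequence_compose:
  assumes [measurable]: "f \<in> borel_measurable borel"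
  shows "iid_sequence M (\<lambda>n \<omega>. f (X n \<omega>))"
proof
  show "indep_vars (\<lambda>_. borel) (\<lambda>n \<omega>. f (X n \<omega>)) UNIV"
    using indep by (rule indep_vars_compose2) auto
  have "distr M borel (\<lambda>\<omega>. f (X n \<omega>)) = distr (distr M borel (X n)) borel f" for n
    by (subst distr_distr) (auto simp: comp_def)
  then show "distr M borel (\<lambda>\<omega>. f (X n \<omega>)) = distr M borel (\<lambda>\<omega>. f (X 0 \<omega>))" for n
    by (simp add: distr_eq[of n])
qed

lemma integral_compose_eq:
  fixes f :: "real \<Rightarrow> real"
  assumes [measurable]: "f \<in> borel_measurable borel"
  shows "(\<integral>\<omega>. f (X n \<omega>) \<partial>M) = (\<integral>\<omega>. f (X 0 \<omega>) \<partial>M)"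
    and "integrable M (\<lambda>\<omega>. f (X n \<omega>)) \<longleftrightarrow> integrable M (\<lambda>\<omega>. f (X 0 \<omega>))"
proof -
  have "(\<integral>\<omega>. f (X n \<omega>) \<partial>M) = (\<integral>x. f x \<partial>distr M borel (X n))"
    "integrable M (\<lambda>\<omega>. f (X n \<omega>)) \<longleftrightarrow> integrable (distr M borel (X n)) f" for n
    by (simp_all add: integral_distr integrable_distr_eq)
  then show "(\<integral>\<omega>. f (X n \<omega>) \<partial>M) = (\<integral>\<omega>. f (X 0 \<omega>) \<partial>M)"
    and "integrable M (\<lambda>\<omega>. f (X n \<omega>)) \<longleftrightarrow> integrable M (\<lambda>\<omega>. f (X 0 \<omega>))"
    by (simp_all add: distr_eq[of n])
qed

text \<open>By induction on \<open>A\<close>: the cross term vanishes, since \<open>X i\<close> is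
  centred and independent of the sum over the other indices.\<close>

lemma
  assumes sq: "integrable M (\<lambda>\<omega>. (X 0 \<omega>)\<^sup>2)" and mean: "expectation (X 0) = 0" and "finite A"
  shows integrable_sum_square: "integrable M (\<lambda>\<omega>. (\<Sum>i\<in>A. X i \<omega>)\<^sup>2)"
    and expectation_sum_square:
      "expectation (\<lambda>\<omega>. (\<Sum>i\<in>A. X i \<omega>)\<^sup>2) = card A * expectation (\<lambda>\<omega>. (X 0 \<omega>)\<^sup>2)"
proof -
  have sqn: "integrable M (\<lambda>\<omega>. (X n \<omega>)\<^sup>2)" for n
    using sq integral_compose_eq(2)[of "\<lambda>x. x\<^sup>2" n] by simp
  have int: "integrable M (X n)" for n
    by (rule square_integrable_imp_integrable[OF _ sqn]) simp
  have ind: "indep_var borel (X i) borel (\<lambda>\<omega>. \<Sum>i\<in>B. X i \<omega>)" if "finite B" "i \<notin> B" for i B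
    using that by (intro indep_vars_sum indep_vars_subset[OF indep]) auto
  have "integrable M (\<lambda>\<omega>. (\<Sum>i\<in>A. X i \<omega>)\<^sup>2) \<and>
    expectation (\<lambda>\<omega>. (\<Sum>i\<in>A. X i \<omega>)\<^sup>2) = card A * expectation (\<lambda>\<omega>. (X 0 \<omega>)\<^sup>2)"
    using \<open>finite A\<close>
  proof induction
    case empty
    then show ?case by simp
  next
    case (insert i A)
    let ?S = "\<lambda>\<omega>. \<Sum>i\<in>A. X i \<omega>"
    have eq: "(\<Sum>j\<in>insert i A. X j \<omega>)\<^sup>2 = (X i \<omega>)\<^sup>2 + 2 * (X i \<omega> * ?S \<omega>) + (?S \<omega>)\<^sup>2" for \<omega>
      using insert by (simp add: power2_sum)
    have intS: "integrable M ?S"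
      using int by auto
    have "integrable M (\<lambda>\<omega>. X i \<omega> * ?S \<omega>)"
      using indep_var_integrable[OF ind[OF insert(1,2)] int intS] .
    moreover have "expectation (\<lambda>\<omega>. X i \<omega> * ?S \<omega>) = 0"
      using indep_var_lebesgue_integral[OF ind[OF insert(1,2)] int intS]
        integral_compose_eq(1)[of "\<lambda>x. x" i] mean by simp
    moreover have "expectation (\<lambda>\<omega>. (X i \<omega>)\<^sup>2) = expectation (\<lambda>\<omega>. (X 0 \<omega>)\<^sup>2)"
      using integral_compose_eq(1)[of "\<lambda>x. x\<^sup>2" i] by simp
    ultimately show ?case
      unfolding eq using insert sqn by (simp add: algebra_simps)
  qed
  then show "integrable M (\<lambda>\<omega>. (\<Sum>i\<in>A. X i \<omega>)\<^sup>2)"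
    and "expectation (\<lambda>\<omega>. (\<Sum>i\<in>A. X i \<omega>)\<^sup>2) = card A * expectation (\<lambda>\<omega>. (X 0 \<omega>)\<^sup>2)"
    by auto
qed

text \<open>Chebyshev's inequality; the scaling by \<open>sqrt n\<close> makes the second moment
  independent of \<open>n\<close>. For \<open>n = 0\<close> the event is empty.\<close>

lemma sqrt_sample_mean_tail:
  assumes sq: "integrable M (\<lambda>\<omega>. (X 0 \<omega>)\<^sup>2)" and mean: "expectation (X 0) = 0" and "K > 0"
  shows "prob {\<omega> \<in> space M. \<bar>sqrt n * sample_mean X n \<omega>\<bar> \<ge> K} \<le> expectation (\<lambda>\<omega>. (X 0 \<omega>)\<^sup>2) / K\<^sup>2"
proof (cases "n = 0")
  case True
  then show ?thesis using \<open>K > 0\<close> by simp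
next
  case False
  have eq: "(sqrt n * sample_mean X n \<omega>)\<^sup>2 = (\<Sum>i=1..n. X i \<omega>)\<^sup>2 / n" for \<omega>
    using False by (simp add: sample_mean_def power_mult_distrib power_divide) (simp add: power2_eq_square)
  have "prob {\<omega> \<in> space M. \<bar>sqrt n * sample_mean X n \<omega>\<bar> \<ge> K}
      \<le> expectation (\<lambda>\<omega>. (sqrt n * sample_mean X n \<omega>)\<^sup>2) / K\<^sup>2"
    by (rule second_moment_method)
      (use integrable_sum_square[OF sq mean, of "{1..n}"] \<open>K > 0\<close> in \<open>auto simp: eq\<close>)
  also have "expectation (\<lambda>\<omega>. (sqrt n * sample_mean X n \<omega>)\<^sup>2) = expectation (\<lambda>\<omega>. (X 0 \<omega>)\<^sup>2)"
    using expectation_sum_square[OF sq mean, of "{1..n}"] False by (simp add: eq)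
  finally show ?thesis .
qed

lemma bounded_in_prob_sqrt_sample_mean:
  assumes sq: "integrable M (\<lambda>\<omega>. (X 0 \<omega>)\<^sup>2)" and mean: "expectation (X 0) = 0"
  shows "bounded_in_prob (\<lambda>n \<omega>. sqrt n * sample_mean X n \<omega>)"
  unfolding bounded_in_prob_def
proof (intro allI impI)
  fix \<eta> :: real assume "\<eta> > 0"
  define v where "v = expectation (\<lambda>\<omega>. (X 0 \<omega>)\<^sup>2)"
  \<comment> \<open>Then \<open>v / K\<^sup>2\<close> is \<open>\<eta> * v / (v + 1)\<close>, at
    most \<open>\<eta>\<close>; the summand 1 keeps \<open>K\<close> positive when
    \<open>v = 0\<close>.\<close>
  define K where "K = sqrt ((v + 1) / \<eta>)"
  have "v \<ge> 0" by (simp add: v_def)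
  with \<open>\<eta> > 0\<close> have "(v + 1) / \<eta> > 0" by (intro divide_pos_pos add_nonneg_pos) auto
  then have K: "K > 0" "K\<^sup>2 = (v + 1) / \<eta>" by (auto simp: K_def)
  have "v / K\<^sup>2 \<le> \<eta>"
    unfolding K(2) using \<open>\<eta> > 0\<close> \<open>v \<ge> 0\<close> by (simp add: field_simps)
  with K(1) show "\<exists>K>0. \<forall>n. prob {\<omega> \<in> space M. K \<le> \<bar>sqrt n * sample_mean X n \<omega>\<bar>} \<le> \<eta>"
    using sqrt_sample_mean_tail[OF sq mean K(1), folded v_def] order_trans by blast
qed

text \<open>The sample mean is \<open>1 / sqrt n\<close> times a sequence bounded in
  probability.\<close>

lemma weak_law_square_integrable:
  assumes sq: "integrable M (\<lambda>\<omega>. (X 0 \<omega>)\<^sup>2)" and mean: "expectation (X 0) = 0"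
  shows "((\<lambda>(n, \<omega>). sample_mean X n \<omega>) \<longlongrightarrow> 0) whp"
proof (rule tendsto_whp_0_if_small_times_bounded[OF _ _ bounded_in_prob_sqrt_sample_mean[OF assms]])
  fix \<epsilon> :: real assume "\<epsilon> > 0"
  have "filterlim (\<lambda>n. sqrt (real n)) at_top sequentially"
    by (intro filterlim_compose[OF sqrt_at_top] filterlim_real_sequentially)
  then have "\<forall>\<^sub>F n in sequentially. sqrt (real n) \<ge> 1 / \<epsilon>"
    by (auto simp: filterlim_at_top)
  from eventually_whp_sequentially[OF this]
  show "\<forall>\<^sub>F (n, \<omega>) in whp. \<bar>sample_mean X n \<omega>\<bar> \<le> \<epsilon> * \<bar>sqrt n * sample_mean X n \<omega>\<bar>"
  proof (rule eventually_mono, clarify)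
    fix n \<omega> assume "1 / \<epsilon> \<le> sqrt (real n)"
    then have "1 * \<bar>sample_mean X n \<omega>\<bar> \<le> (\<epsilon> * sqrt n) * \<bar>sample_mean X n \<omega>\<bar>"
      using \<open>\<epsilon> > 0\<close> by (intro mult_right_mono) (auto simp: field_simps)
    then show "\<bar>sample_mean X n \<omega>\<bar> \<le> \<epsilon> * \<bar>sqrt n * sample_mean X n \<omega>\<bar>"
      by (simp add: abs_mult)
  qed
qed measurable

text \<open>Khintchine's weak law: only the first moment is needed, by truncation.\<close>

lemma weak_law:
  assumes int: "integrable M (X 0)"
  shows "((\<lambda>(n, \<omega>). sample_mean X n \<omega>) \<longlongrightarrow> expectation (X 0)) whp"
proof (subst tendsto_whp_iff, measurable, intro allI impI tendstoI)
  fix \<epsilon> \<delta> :: real assume "\<epsilon> > 0" "\<delta> > 0"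
  define T where "T m x = (if \<bar>x\<bar> \<le> real m then x else 0)" for m :: nat and x :: real
  have [measurable]: "T m \<in> borel_measurable borel" for m
    unfolding T_def by measurable
  \<comment> \<open>The first bound limits the bias of the truncated mean to
    \<open>\<epsilon> / 3\<close>, the second makes Markov's bound
    \<open>\<eta> / (\<epsilon> / 3)\<close> for the truncation error at most
    \<open>\<delta> / 2\<close>.\<close>
  define \<eta> where "\<eta> = min (\<epsilon> / 3) (\<epsilon> * \<delta> / 6)"
  have "\<eta> > 0" using \<open>\<epsilon> > 0\<close> \<open>\<delta> > 0\<close> by (simp add: \<eta>_def)
  have "(\<lambda>m. expectation (\<lambda>\<omega>. \<bar>X 0 \<omega> - T m (X 0 \<omega>)\<bar>)) \<longlonglongrightarrow> expectation (\<lambda>\<omega>. 0)"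
  proof (rule integral_dominated_convergence[where w = "\<lambda>\<omega>. \<bar>X 0 \<omega>\<bar>"])
    have "(\<lambda>m. \<bar>x - T m x\<bar>) \<longlonglongrightarrow> 0" for x
    proof (rule tendsto_eventually)
      show "\<forall>\<^sub>F m in sequentially. \<bar>x - T m x\<bar> = 0"
        using eventually_ge_at_top[of "nat \<lceil>\<bar>x\<bar>\<rceil>"] by eventually_elim (simp add: T_def nat_le_iff ceiling_le_iff)
    qed
    then show "AE \<omega> in M. (\<lambda>m. \<bar>X 0 \<omega> - T m (X 0 \<omega>)\<bar>) \<longlonglongrightarrow> 0"
      by simp
  qed (use int in \<open>auto simp: T_def\<close>)
  then have "\<forall>\<^sub>F m in sequentially. expectation (\<lambda>\<omega>. \<bar>X 0 \<omega> - T m (X 0 \<omega>)\<bar>) < \<eta>"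
    using \<open>\<eta> > 0\<close> by (intro order_tendstoD(2)) auto
  then obtain m where m: "expectation (\<lambda>\<omega>. \<bar>X 0 \<omega> - T m (X 0 \<omega>)\<bar>) < \<eta>"
    by (auto simp: eventually_sequentially)
  have intT: "integrable M (\<lambda>\<omega>. T m (X 0 \<omega>))"
    by (rule integrable_const_bound[where B = "real m"]) (auto simp: T_def)
  define c where "c = expectation (\<lambda>\<omega>. T m (X 0 \<omega>))"
  \<comment> \<open>\<open>U\<close> is the centred truncated variable, bounded and hence square
    integrable; \<open>V\<close> is the size of the truncation error, small in mean.\<close>
  define U where "U n \<omega> = T m (X n \<omega>) - c" for n \<omega>
  define V where "V n \<omega> = \<bar>X n \<omega> - T m (X n \<omega>)\<bar>" for n \<omega>
  interpret U: iid_sequence M U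
    unfolding U_def by (rule iid_sequence_compose) measurable
  interpret V: iid_sequence M V
    unfolding V_def by (rule iid_sequence_compose) measurable
  have "expectation (U 0) = 0"
    using intT by (simp add: U_def[abs_def] c_def prob_space)
  moreover have "integrable M (\<lambda>\<omega>. (U 0 \<omega>)\<^sup>2)"
  proof (rule integrable_const_bound[where B = "(real m + \<bar>c\<bar>)\<^sup>2"])
    have "\<bar>U 0 \<omega>\<bar> \<le> real m + \<bar>c\<bar>" for \<omega>
      by (auto simp: U_def T_def)
    then show "AE \<omega> in M. norm ((U 0 \<omega>)\<^sup>2) \<le> (real m + \<bar>c\<bar>)\<^sup>2"
      by (auto simp: power2_le_iff_abs_le intro!: AE_I2)
  qed simp
  ultimately have "((\<lambda>(n, \<omega>). sample_mean U n \<omega>) \<longlongrightarrow> 0) whp"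
    by (intro U.weak_law_square_integrable)
  then have "(\<lambda>n. prob {\<omega> \<in> space M. \<bar>sample_mean U n \<omega>\<bar> > \<epsilon> / 3}) \<longlonglongrightarrow> 0"
    using \<open>\<epsilon> > 0\<close> tendsto_whp_iff[THEN iffD1, rule_format, of "sample_mean U" 0 "\<epsilon> / 3"] by simp
  then have "\<forall>\<^sub>F n in sequentially. prob {\<omega> \<in> space M. \<bar>sample_mean U n \<omega>\<bar> > \<epsilon> / 3} < \<delta> / 2"
    using \<open>\<delta> > 0\<close> by (intro order_tendstoD(2)) auto
  then show "\<forall>\<^sub>F n in sequentially.
      dist (prob {\<omega> \<in> space M. \<epsilon> < \<bar>sample_mean X n \<omega> - expectation (X 0)\<bar>}) 0 < \<delta>"
    using eventually_gt_at_top[of 0]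
  proof eventually_elim
    case (elim n)
    have intV: "integrable M (V i)" "expectation (V i) = expectation (V 0)" for i
      using V.integral_compose_eq[of "\<lambda>x. x" i] int intT by (auto simp: V_def[abs_def])
    have V0: "expectation (V 0) < \<eta>"
      using m by (simp add: V_def[abs_def])
    have "prob {\<omega> \<in> space M. sample_mean V n \<omega> \<ge> \<epsilon> / 3} \<le> expectation (sample_mean V n) / (\<epsilon> / 3)"
    proof (rule integral_Markov_inequality_measure[where A = "{}"])
      show "integrable M (sample_mean V n)"
        using intV(1) by (simp add: sample_mean_def[abs_def])
    qed (use \<open>\<epsilon> > 0\<close> in \<open>auto simp: sample_mean_def V_def intro!: sum_nonneg\<close>)
    also have "expectation (sample_mean V n) = expectation (V 0)"
    proof -
      have "(\<Sum>i=1..n. expectation (V i)) = (\<Sum>i=1..n. expectation (V 0))"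
        by (intro sum.cong refl intV(2))
      then show ?thesis
        using elim(2) intV(1) by (simp add: sample_mean_def[abs_def])
    qed
    also have "expectation (V 0) / (\<epsilon> / 3) < \<eta> / (\<epsilon> / 3)"
      using V0 \<open>\<epsilon> > 0\<close> by (intro divide_strict_right_mono) auto
    also have "\<eta> / (\<epsilon> / 3) \<le> \<delta> / 2"
      using \<open>\<epsilon> > 0\<close> by (simp add: \<eta>_def field_simps)
    finally have *: "prob {\<omega> \<in> space M. sample_mean V n \<omega> \<ge> \<epsilon> / 3} < \<delta> / 2" .
    have c: "\<bar>c - expectation (X 0)\<bar> \<le> \<epsilon> / 3"
    proof -
      have "\<bar>expectation (\<lambda>\<omega>. X 0 \<omega> - T m (X 0 \<omega>))\<bar> \<le> expectation (V 0)"
        unfolding V_def by (rule integral_abs_bound)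
      then show ?thesis
        using V0 int intT by (simp add: c_def \<eta>_def abs_minus_commute)
    qed
    \<comment> \<open>The error splits into the fluctuation of the truncated mean, its bias and the
      averaged truncation error. The bias is at most \<open>\<epsilon> / 3\<close>, so one of the
      others must reach \<open>\<epsilon> / 3\<close>.\<close>
    have "\<epsilon> / 3 < \<bar>sample_mean U n \<omega>\<bar> \<or> \<epsilon> / 3 \<le> sample_mean V n \<omega>"
      if "\<epsilon> < \<bar>sample_mean X n \<omega> - expectation (X 0)\<bar>" for \<omega>
    proof -
      have "sample_mean X n \<omega> = sample_mean U n \<omega> + c + (\<Sum>i=1..n. X i \<omega> - T m (X i \<omega>)) / n"
        using elim(2) by (simp add: sample_mean_def U_def sum_subtractf diff_divide_distrib)
      moreover have "\<bar>(\<Sum>i=1..n. X i \<omega> - T m (X i \<omega>)) / n\<bar> \<le> sample_mean V n \<omega>"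
        by (simp add: sample_mean_def V_def divide_right_mono)
      ultimately show ?thesis using that c by linarith
    qed
    then have "prob {\<omega> \<in> space M. \<epsilon> < \<bar>sample_mean X n \<omega> - expectation (X 0)\<bar>}
        \<le> prob ({\<omega> \<in> space M. \<bar>sample_mean U n \<omega>\<bar> > \<epsilon> / 3} \<union> {\<omega> \<in> space M. sample_mean V n \<omega> \<ge> \<epsilon> / 3})"
      by (intro finite_measure_mono) auto
    also have "\<dots> \<le> prob {\<omega> \<in> space M. \<bar>sample_mean U n \<omega>\<bar> > \<epsilon> / 3} + prob {\<omega> \<in> space M. sample_mean V n \<omega> \<ge> \<epsilon> / 3}"
      by (intro measure_Un_le) auto
    finally show ?case using elim(1) * by simp
  qed
qed

lemma char_sum_eq_power:
  "char (distr M borel (\<lambda>\<omega>. \<Sum>i\<in>A. X i \<omega>)) t = char (distr M borel (X 0)) t ^ card A"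
proof -
  have "char (distr M borel (\<lambda>\<omega>. \<Sum>i\<in>A. X i \<omega>)) t = (\<Prod>i\<in>A. char (distr M borel (X i)) t)"
    by (rule char_distr_sum) (rule indep_vars_subset[OF indep], simp)
  also have "\<dots> = (\<Prod>i\<in>A. char (distr M borel (X 0)) t)"
    by (rule prod.cong[OF refl], subst distr_eq, rule refl)
  finally show ?thesis by simp
qed

text \<open>For \<open>v = 0\<close> all the characteristic functions are 1. For
  \<open>v > 0\<close> this is the classical central limit theorem; its sums over
  \<open>{..<n}\<close> and those over \<open>{1..n}\<close> have the same characteristic function,
  a power of that of \<open>X 0\<close>.\<close>

lemma char_sqrt_sample_mean_tendsto:
  assumes sq: "integrable M (\<lambda>\<omega>. (X 0 \<omega>)\<^sup>2)" and mean: "expectation (X 0) = 0"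
  defines "v \<equiv> expectation (\<lambda>\<omega>. (X 0 \<omega>)\<^sup>2)"
  shows "(\<lambda>n. char (distr M borel (\<lambda>\<omega>. sqrt n * sample_mean X n \<omega>)) t)
    \<longlonglongrightarrow> complex_of_real (exp (- (v * t\<^sup>2) / 2))"
proof -
  have eq: "char (distr M borel (\<lambda>\<omega>. sqrt n * sample_mean X n \<omega>)) t
      = char (distr M borel (X 0)) (t / sqrt n) ^ n" for n
  proof -
    have "sqrt n * sample_mean X n \<omega> = (1 / sqrt n) * (\<Sum>i=1..n. X i \<omega>)" for \<omega>
      by (simp add: sample_mean_def real_div_sqrt divide_simps)
    then show ?thesis
      by (simp only: char_distr_cmult char_sum_eq_power borel_measurable_sum measurable_X) simp
  qed
  show ?thesis
  proof (cases "v = 0")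
    case True
    then have "AE \<omega> in M. X 0 \<omega> = 0"
      using sq unfolding v_def by (subst (asm) integral_nonneg_eq_0_iff_AE) auto
    then have "(\<integral>\<omega>. iexp (s * X 0 \<omega>) \<partial>M) = (\<integral>\<omega>. 1 \<partial>M)" for s
      by (intro integral_cong_AE) auto
    then have "char (distr M borel (X 0)) s = 1" for s
      by (simp add: char_def integral_distr prob_space)
    then show ?thesis
      unfolding eq using True by simp
  next
    case False
    then have v: "v > 0" unfolding v_def by (simp add: less_le)
    have X: "expectation (X n) = 0" "integrable M (\<lambda>\<omega>. (X n \<omega>)\<^sup>2)" "variance (X n) = (sqrt v)\<^sup>2" for n
      using integral_compose_eq(1)[of "\<lambda>x. x" n] integral_compose_eq[of "\<lambda>x. x\<^sup>2" n] sq mean v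
      by (auto simp: v_def)
    have weak: "weak_conv_m (\<lambda>n. distr M borel (\<lambda>x. (\<Sum>i<n. X i x) / sqrt (n * (sqrt v)\<^sup>2))) std_normal_distribution"
      using X v by (intro central_limit_theorem_zero_mean[OF indep _ _ _ _ distr_eq]) auto
    \<comment> \<open>Evaluation at \<open>sqrt v * t\<close> undoes the normalization by the
      standard deviation.\<close>
    have "(\<lambda>n. char (distr M borel (\<lambda>x. (\<Sum>i<n. X i x) / sqrt (n * (sqrt v)\<^sup>2))) (sqrt v * t))
        \<longlonglongrightarrow> char std_normal_distribution (sqrt v * t)"
      by (rule levy_continuity1[OF _ real_dist_normal_dist weak]) simp
    moreover have "char (distr M borel (\<lambda>x. (\<Sum>i<n. X i x) / sqrt (n * (sqrt v)\<^sup>2))) (sqrt v * t)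
        = char (distr M borel (X 0)) (t / sqrt n) ^ n" for n
    proof -
      have "(\<Sum>i<n. X i x) / sqrt (n * (sqrt v)\<^sup>2) = (1 / (sqrt n * sqrt v)) * (\<Sum>i<n. X i x)" for x
        using v by (simp add: real_sqrt_mult)
      then show ?thesis
        using v by (simp only: char_distr_cmult char_sum_eq_power borel_measurable_sum measurable_X) simp
    qed
    ultimately show ?thesis
      unfolding eq using v by (simp add: char_std_normal_distribution power_mult_distrib)
  qed
qed

end

section \<open>The empirical Lorenz curve\<close>

definition lorenz_objective :: "(nat \<Rightarrow> 'a \<Rightarrow> real) \<Rightarrow> real \<Rightarrow> real \<Rightarrow> nat \<Rightarrow> 'a \<Rightarrow> real" where
  "lorenz_objective X p t n \<omega> = p * t - sample_mean (\<lambda>i \<omega>. max 0 (t - X i \<omega>)) n \<omega>"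

lemma sample_mean_mono:
  assumes "\<And>i. f i \<omega> \<le> g i \<omega>"
  shows "sample_mean f n \<omega> \<le> sample_mean g n \<omega>"
  using assms by (simp add: sample_mean_def sum_mono divide_right_mono)

lemma sample_mean_add_cmult:
  "sample_mean (\<lambda>i \<omega>. f i \<omega> + c * g i \<omega>) n \<omega> = sample_mean f n \<omega> + c * sample_mean g n \<omega>"
  by (simp add: sample_mean_def sum.distrib add_divide_distrib flip: sum_distrib_left)

lemma sample_mean_const: "n > 0 \<Longrightarrow> sample_mean (\<lambda>i \<omega>. c) n \<omega> = c"
  by (simp add: sample_mean_def)

text \<open>The empirical weights of both \<open>{..s}\<close> and \<open>{..<s}\<close> give supergradients at \<open>s\<close>
  of the concave function \<open>lorenz_objective\<close>.\<close>

lemma lorenz_objective_le_supergradient: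
  assumes "A = {..s} \<or> A = {..<s}"
  shows "lorenz_objective X p t n \<omega>
    \<le> lorenz_objective X p s n \<omega> + (t - s) * (p - sample_mean (\<lambda>i \<omega>. indicat_real A (X i \<omega>)) n \<omega>)"
proof -
  have "max 0 (s - X i \<omega>) + (t - s) * indicat_real A (X i \<omega>) \<le> max 0 (t - X i \<omega>)" for i
    using assms by (auto simp: indicator_def)
  then have "sample_mean (\<lambda>i \<omega>. max 0 (s - X i \<omega>) + (t - s) * indicat_real A (X i \<omega>)) n \<omega>
      \<le> sample_mean (\<lambda>i \<omega>. max 0 (t - X i \<omega>)) n \<omega>"
    by (rule sample_mean_mono)
  then show ?thesis
    unfolding lorenz_objective_def sample_mean_add_cmult by (simp add: algebra_simps)
qed

text \<open>A supergradient is \<open>p\<close> minus an empirical weight, and both lie between 0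
  and 1.\<close>

lemma lorenz_objective_lipschitz:
  assumes "n > 0" "0 < p" "p < 1"
  shows "lorenz_objective X p t n \<omega> \<le> lorenz_objective X p s n \<omega> + \<bar>t - s\<bar>"
proof -
  let ?c = "sample_mean (\<lambda>i \<omega>. indicat_real {..s} (X i \<omega>)) n \<omega>"
  have "0 \<le> ?c" "?c \<le> 1"
    using sample_mean_mono[of "\<lambda>i \<omega>. 0" \<omega> "\<lambda>i \<omega>. indicat_real {..s} (X i \<omega>)" n]
      sample_mean_mono[of "\<lambda>i \<omega>. indicat_real {..s} (X i \<omega>)" \<omega> "\<lambda>i \<omega>. 1" n] assms(1)
    by (auto simp: sample_mean_const)
  then have "\<bar>p - ?c\<bar> \<le> 1"
    using assms by linarith
  then have "\<bar>t - s\<bar> * \<bar>p - ?c\<bar> \<le> \<bar>t - s\<bar> * 1"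
    by (intro mult_left_mono) auto
  moreover have "(t - s) * (p - ?c) \<le> \<bar>t - s\<bar> * \<bar>p - ?c\<bar>"
    by (simp flip: abs_mult)
  ultimately show ?thesis
    using lorenz_objective_le_supergradient[of "{..s}" s X p t n \<omega>] by simp
qed

text \<open>The positive part is bounded below by 0 and by \<open>t - X i \<omega>\<close>. The two
  resulting lines control the objective outside a compact interval.\<close>

lemma lorenz_objective_bounds:
  assumes "n > 0"
  shows "lorenz_objective X p t n \<omega> \<le> p * t"
    and "lorenz_objective X p t n \<omega> \<le> sample_mean X n \<omega> - (1 - p) * t"
proof -
  have "0 \<le> sample_mean (\<lambda>i \<omega>. max 0 (t - X i \<omega>)) n \<omega>"
    using sample_mean_mono[of "\<lambda>i \<omega>. 0" \<omega> "\<lambda>i \<omega>. max 0 (t - X i \<omega>)" n] assms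
    by (simp add: sample_mean_const)
  then show "lorenz_objective X p t n \<omega> \<le> p * t"
    by (simp add: lorenz_objective_def)
  have "sample_mean (\<lambda>i \<omega>. t + (-1) * X i \<omega>) n \<omega> \<le> sample_mean (\<lambda>i \<omega>. max 0 (t - X i \<omega>)) n \<omega>"
    by (rule sample_mean_mono) auto
  then show "lorenz_objective X p t n \<omega> \<le> sample_mean X n \<omega> - (1 - p) * t"
    unfolding sample_mean_add_cmult using assms
    by (simp add: lorenz_objective_def sample_mean_const algebra_simps)
qed

section \<open>Consistency of the empirical Lorenz curve\<close>

locale lorenz_sample = iid_sequence +
  fixes p :: real
  assumes integrable_X: "integrable M (X 0)" and p: "0 < p" "p < 1"
begin

sublocale D: cdf_distribution "distr M borel (X 0)"
  by (intro cdf_distribution.intro real_distribution_distr) simp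

definition "q = D.I p"
definition "G = (LBINT u=0..p. real_of_ereal (quantile D.C u))"
definition "Gn n \<omega> = (LBINT u=0..p. real_of_ereal (quantile (empirical_cdf X n \<omega>) u))"
definition "h t = p * t - expectation (\<lambda>\<omega>. max 0 (t - X 0 \<omega>))"

lemma integrable_D: "integrable (distr M borel (X 0)) (\<lambda>x. x)"
  using integrable_X by (simp add: integrable_distr_eq)

lemma integrable_shortfall: "integrable M (\<lambda>\<omega>. max 0 (t - X 0 \<omega>))"
  using integrable_X by (intro integrable_max) auto

lemma h_le_G: "h t \<le> G"
  using D.quantile_integral_ge[OF integrable_D p, of t]
  by (simp add: h_def G_def integral_distr)

lemma G_eq: "G = h q"
  using D.quantile_integral_eq[OF integrable_D p]
  by (simp add: h_def G_def q_def integral_distr)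

lemma objective_le_Gn: "n > 0 \<Longrightarrow> lorenz_objective X p t n \<omega> \<le> Gn n \<omega>"
  using empirical_quantile_integral_ge[OF _ p] by (simp add: lorenz_objective_def Gn_def)

lemma ex_Gn_eq_objective: "n > 0 \<Longrightarrow> \<exists>t. Gn n \<omega> = lorenz_objective X p t n \<omega>"
  using empirical_quantile_integral_eq[OF _ p] unfolding lorenz_objective_def Gn_def .

lemma measurable_objective [measurable]: "lorenz_objective X p t n \<in> borel_measurable M"
  unfolding lorenz_objective_def sample_mean_def by measurable

text \<open>\<open>Gn\<close> is a supremum of measurable objectives, and by the Lipschitz bound
  rational arguments suffice to compute it.\<close>

lemma measurable_Gn [measurable]:
  assumes n: "n > 0"
  shows "Gn n \<in> borel_measurable M"
  unfolding borel_measurable_iff_le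
proof
  fix c
  have "Gn n \<omega> \<le> c" if le: "\<forall>r::rat. lorenz_objective X p (of_rat r) n \<omega> \<le> c" for \<omega>
  proof (rule ccontr)
    assume "\<not> Gn n \<omega> \<le> c"
    obtain t where t: "Gn n \<omega> = lorenz_objective X p t n \<omega>"
      using ex_Gn_eq_objective[OF n] by blast
    \<comment> \<open>Moving from the maximizer to \<open>r\<close> loses less than the excess of
      \<open>Gn n \<omega>\<close> over \<open>c\<close>.\<close>
    obtain r :: rat where "t < of_rat r" "of_rat r < t + (Gn n \<omega> - c)"
      using of_rat_dense[of t "t + (Gn n \<omega> - c)"] \<open>\<not> Gn n \<omega> \<le> c\<close> by auto
    then show False
      using lorenz_objective_lipschitz[OF n p, of X t \<omega> "of_rat r"] le[rule_format, of r] t by simp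
  qed
  then have "{\<omega> \<in> space M. Gn n \<omega> \<le> c} = {\<omega> \<in> space M. \<forall>r::rat. lorenz_objective X p (of_rat r) n \<omega> \<le> c}"
    using order_trans[OF objective_le_Gn[OF n]] by blast
  also have "\<dots> \<in> events"
    by measurable
  finally show "{\<omega> \<in> space M. Gn n \<omega> \<le> c} \<in> events" .
qed

lemma weak_law_compose:
  assumes [measurable]: "f \<in> borel_measurable borel" and "integrable M (\<lambda>\<omega>. f (X 0 \<omega>))"
  shows "((\<lambda>(n, \<omega>). sample_mean (\<lambda>i \<omega>. f (X i \<omega>)) n \<omega>) \<longlongrightarrow> expectation (\<lambda>\<omega>. f (X 0 \<omega>))) whp"
proof -
  interpret f: iid_sequence M "\<lambda>n \<omega>. f (X n \<omega>)"
    by (rule iid_sequence_compose) fact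
  show ?thesis
    by (rule f.weak_law) fact
qed

lemma objective_tendsto: "((\<lambda>(n, \<omega>). lorenz_objective X p t n \<omega>) \<longlongrightarrow> h t) whp"
  using tendsto_diff[OF tendsto_const weak_law_compose[OF _ integrable_shortfall], of t "p * t"]
  by (simp add: lorenz_objective_def h_def case_prod_unfold)

lemma eventually_whp_pos: "\<forall>\<^sub>F (n, \<omega>) in whp. n > 0"
  by (rule eventually_whp_sequentially) (rule eventually_gt_at_top)

text \<open>The value at \<open>q\<close> bounds \<open>Gn\<close> from below. From above, an
  empirical maximizer lies either where a linear bound already gives at most \<open>G\<close>, or
  near one of finitely many net points where the weak law holds simultaneously.\<close>

lemma Gn_tendsto: "((\<lambda>(n, \<omega>). Gn n \<omega>) \<longlongrightarrow> G) whp"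
proof (rule tendstoI)
  fix e :: real assume "e > 0"
  define \<mu> where "\<mu> = expectation (X 0)"
  \<comment> \<open>At \<open>a\<close> the line \<open>p * t\<close> has height \<open>G\<close>;
    at \<open>b\<close> the line \<open>\<mu> + 1 - (1 - p) * t\<close> has, where
    \<open>\<mu> + 1\<close> exceeds the sample mean with high probability.\<close>
  define a where "a = G / p"
  define b where "b = (\<mu> + 1 - G) / (1 - p)"
  obtain T where T: "finite T" "{a..b} \<subseteq> (\<Union>s\<in>T. ball s (e / 2))"
    using seq_compact_imp_totally_bounded[of "{a..b}"] \<open>e > 0\<close>
    by (metis compact_Icc compact_imp_seq_compact half_gt_zero)
  have "\<forall>\<^sub>F (n, \<omega>) in whp. lorenz_objective X p s n \<omega> < h s + e / 2" for s
    using order_tendstoD(2)[OF objective_tendsto, of s "h s + e / 2"] \<open>e > 0\<close> by (simp add: case_prod_unfold)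
  then have "\<forall>\<^sub>F z in whp. \<forall>s\<in>T. lorenz_objective X p s (fst z) (snd z) < h s + e / 2"
    by (intro eventually_ball_finite[OF T(1)]) (simp add: case_prod_unfold)
  moreover have "\<forall>\<^sub>F (n, \<omega>) in whp. lorenz_objective X p q n \<omega> > G - e"
    using order_tendstoD(1)[OF objective_tendsto, of "G - e" q] \<open>e > 0\<close> G_eq by (simp add: case_prod_unfold)
  moreover have "\<forall>\<^sub>F (n, \<omega>) in whp. sample_mean X n \<omega> < \<mu> + 1"
    using order_tendstoD(2)[OF weak_law[OF integrable_X], of "\<mu> + 1"] by (simp add: case_prod_unfold \<mu>_def)
  ultimately show "\<forall>\<^sub>F z in whp. dist (case z of (n, \<omega>) \<Rightarrow> Gn n \<omega>) G < e"
    using eventually_whp_pos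
  proof eventually_elim
    case (elim z)
    obtain n \<omega> where z: "z = (n, \<omega>)" by (cases z)
    have n: "n > 0" and T': "\<And>s. s \<in> T \<Longrightarrow> lorenz_objective X p s n \<omega> < h s + e / 2"
      and lower: "lorenz_objective X p q n \<omega> > G - e" and mean: "sample_mean X n \<omega> < \<mu> + 1"
      using elim by (auto simp: z)
    obtain t where t: "Gn n \<omega> = lorenz_objective X p t n \<omega>"
      using ex_Gn_eq_objective[OF n] by blast
    consider "t < a" | "t > b" | "t \<in> {a..b}" by fastforce
    then have "Gn n \<omega> < G + e"
    proof cases
      case 1
      then have "p * t \<le> G" using p by (simp add: a_def field_simps)
      then show ?thesis using lorenz_objective_bounds(1)[OF n, of X p t \<omega>] t \<open>e > 0\<close> by linarith
    next
      case 2
      then have "(1 - p) * t \<ge> \<mu> + 1 - G" using p by (simp add: b_def field_simps)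
      then show ?thesis using lorenz_objective_bounds(2)[OF n, of X p t \<omega>] t mean \<open>e > 0\<close> by linarith
    next
      case 3
      then obtain s where s: "s \<in> T" "t \<in> ball s (e / 2)"
        using T(2) by blast
      then have "\<bar>t - s\<bar> < e / 2"
        by (simp add: dist_real_def abs_minus_commute)
      with s(1) show ?thesis
        using lorenz_objective_lipschitz[OF n p, of X t \<omega> s] T'[of s] h_le_G[of s] t by linarith
    qed
    moreover have "Gn n \<omega> > G - e"
      using objective_le_Gn[OF n, of q \<omega>] lower by linarith
    ultimately show ?case
      by (simp add: z dist_real_def)
  qed
qed

lemma empirical_lorenz_curve_eq: "empirical_lorenz_curve X p n \<omega> = 1 / sample_mean X n \<omega> * Gn n \<omega>"
  by (simp add: empirical_lorenz_curve_def lorenz_curve_def Gn_def)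

lemma measurable_empirical_lorenz_curve [measurable]: "empirical_lorenz_curve X p n \<in> borel_measurable M"
proof (cases "n = 0")
  case True
  \<comment> \<open>For the empty sample the mean is 0 by the convention for division by zero, and
    so is its reciprocal.\<close>
  then have "empirical_lorenz_curve X p n = (\<lambda>\<omega>. 0)"
    by (simp add: fun_eq_iff empirical_lorenz_curve_eq sample_mean_def)
  then show ?thesis by simp
next
  case False
  then have [measurable]: "Gn n \<in> borel_measurable M" by (intro measurable_Gn) simp
  show ?thesis
    unfolding empirical_lorenz_curve_eq[abs_def] by measurable
qed

lemma empirical_lorenz_curve_converges_in_probability:
  assumes "expectation (X 0) \<noteq> 0"
  shows "converges_in_probability M (empirical_lorenz_curve X p) (\<lambda>_. lorenz_curve D.C (expectation (X 0)) p)"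
proof -
  have "((\<lambda>z. 1 / (case z of (n, \<omega>) \<Rightarrow> sample_mean X n \<omega>) * (case z of (n, \<omega>) \<Rightarrow> Gn n \<omega>))
      \<longlongrightarrow> 1 / expectation (X 0) * G) whp"
    using assms by (intro tendsto_intros weak_law integrable_X Gn_tendsto)
  then have "((\<lambda>(n, \<omega>). empirical_lorenz_curve X p n \<omega>) \<longlongrightarrow> lorenz_curve D.C (expectation (X 0)) p) whp"
    by (simp add: empirical_lorenz_curve_eq lorenz_curve_def G_def case_prod_unfold)
  then show ?thesis
    unfolding converges_in_probability_def by (subst (asm) tendsto_whp_iff) auto
qed

section \<open>Replacing the empirical maximum by the value at the true quantile\<close>

lemma expectation_indicator:
  assumes "A \<in> sets borel"
  shows "expectation (\<lambda>\<omega>. indicat_real A (X 0 \<omega>)) = measure (distr M borel (X 0)) A"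
proof -
  have "expectation (\<lambda>\<omega>. indicat_real A (X 0 \<omega>)) = (\<integral>x. indicat_real A x \<partial>distr M borel (X 0))"
    using assms by (subst integral_distr) auto
  then show ?thesis by simp
qed

lemma empirical_weight_tendsto:
  assumes "A \<in> sets borel"
  shows "((\<lambda>(n, \<omega>). sample_mean (\<lambda>i \<omega>. indicat_real A (X i \<omega>)) n \<omega>)
    \<longlongrightarrow> measure (distr M borel (X 0)) A) whp"
proof -
  have "integrable M (\<lambda>\<omega>. indicat_real A (X 0 \<omega>))"
    using assms by (intro integrable_const_bound[where B = 1]) (auto simp: indicator_def)
  from weak_law_compose[OF _ this] assms show ?thesis
    by (simp add: expectation_indicator)
qed

lemma bounded_in_prob_compose:
  assumes [measurable]: "f \<in> borel_measurable borel"
    and "integrable M (\<lambda>\<omega>. (f (X 0 \<omega>))\<^sup>2)" "expectation (\<lambda>\<omega>. f (X 0 \<omega>)) = 0"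
  shows "bounded_in_prob (\<lambda>n \<omega>. sqrt n * sample_mean (\<lambda>i \<omega>. f (X i \<omega>)) n \<omega>)"
proof -
  interpret f: iid_sequence M "\<lambda>n \<omega>. f (X n \<omega>)"
    by (rule iid_sequence_compose) fact
  show ?thesis
    by (rule f.bounded_in_prob_sqrt_sample_mean) fact+
qed

text \<open>The empirical process at \<open>A\<close>: the scaled difference between empirical and
  true weight.\<close>

definition "deviation A n \<omega> = sqrt n *
  sample_mean (\<lambda>i \<omega>. indicat_real A (X i \<omega>) - measure (distr M borel (X 0)) A) n \<omega>"

lemma measurable_deviation [measurable]:
  assumes [measurable]: "A \<in> sets borel"
  shows "deviation A n \<in> borel_measurable M"
  unfolding deviation_def sample_mean_def by measurable

lemma bounded_in_prob_deviation:
  assumes A [measurable]: "A \<in> sets borel"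
  shows "bounded_in_prob (deviation A)"
proof -
  let ?c = "measure (distr M borel (X 0)) A"
  have "bounded_in_prob (\<lambda>n \<omega>. sqrt n * sample_mean (\<lambda>i \<omega>. indicat_real A (X i \<omega>) - ?c) n \<omega>)"
  proof (rule bounded_in_prob_compose)
    have int: "integrable M (\<lambda>\<omega>. indicat_real A (X 0 \<omega>))"
      using A by (intro integrable_const_bound[where B = 1]) (auto simp: indicator_def)
    then show "expectation (\<lambda>\<omega>. indicat_real A (X 0 \<omega>) - ?c) = 0"
      using A by (simp add: expectation_indicator prob_space)
    show "integrable M (\<lambda>\<omega>. (indicat_real A (X 0 \<omega>) - ?c)\<^sup>2)"
    proof (rule integrable_const_bound[where B = 1])
      have "0 \<le> ?c" "?c \<le> 1" by auto
      then have "\<bar>indicat_real A x - ?c\<bar> \<le> 1" for x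
        by (auto simp: indicator_def)
      then show "AE \<omega> in M. norm ((indicat_real A (X 0 \<omega>) - ?c)\<^sup>2) \<le> 1"
        by (simp add: abs_square_le_1)
    qed measurable
  qed measurable
  then show ?thesis
    by (simp add: deviation_def[abs_def])
qed

text \<open>On the event that the empirical weights of \<open>{..q + \<epsilon>}\<close> and \<open>{..q - \<epsilon>}\<close> lie on the correct
  sides of \<open>p\<close>, the empirical objective is maximal within \<open>\<epsilon>\<close> of \<open>q\<close>, and its supergradients at \<open>q\<close>
  have size \<open>O\<^sub>P(1 / sqrt n)\<close> on the relevant side.\<close>

lemma remainder_le_deviation:
  assumes cont: "isCont (quantile D.C) p" and "\<epsilon> > 0"
  shows "\<forall>\<^sub>F (n, \<omega>) in whp. \<bar>sqrt n * (Gn n \<omega> - lorenz_objective X p q n \<omega>)\<bar>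
    \<le> \<epsilon> * \<bar>\<bar>deviation {..q} n \<omega>\<bar> + \<bar>deviation {..<q} n \<omega>\<bar>\<bar>"
proof -
  let ?w = "\<lambda>A n \<omega>. sample_mean (\<lambda>i \<omega>. indicat_real A (X i \<omega>)) n \<omega>"
  have pseudo: "p \<le> D.C x \<longleftrightarrow> q \<le> x" for x
    using D.pseudoinverse[OF p] unfolding q_def .
  \<comment> \<open>Here continuity of the quantile function enters: the slope of the objective is
    strictly negative at \<open>q + \<epsilon>\<close>.\<close>
  have "p < D.C (q + \<epsilon>)"
    using D.cdf_greater_if_quantile_continuous[OF p cont] \<open>\<epsilon> > 0\<close> by (simp add: q_def)
  then have right: "\<forall>\<^sub>F (n, \<omega>) in whp. p < ?w {..q + \<epsilon>} n \<omega>"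
    using order_tendstoD(1)[OF empirical_weight_tendsto, of "{..q + \<epsilon>}" p]
    by (simp add: cdf_def case_prod_unfold)
  have "D.C (q - \<epsilon>) < p"
    using pseudo[of "q - \<epsilon>"] \<open>\<epsilon> > 0\<close> by simp
  then have left: "\<forall>\<^sub>F (n, \<omega>) in whp. ?w {..q - \<epsilon>} n \<omega> < p"
    using order_tendstoD(2)[OF empirical_weight_tendsto, of "{..q - \<epsilon>}" p]
    by (simp add: cdf_def case_prod_unfold)
  define a where "a = measure (distr M borel (X 0)) {..q}"
  define b where "b = measure (distr M borel (X 0)) {..<q}"
  have a: "p \<le> a"
    using pseudo[of q] by (simp add: a_def cdf_def)
  have b: "b \<le> p"
    using D.measure_lessThan_quantile_le[OF p] unfolding b_def q_def .
  show ?thesis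
    using right left eventually_whp_pos
  proof eventually_elim
    case (elim z)
    obtain n \<omega> where z: "z = (n, \<omega>)" by (cases z)
    have n: "n > 0" and r: "p < ?w {..q + \<epsilon>} n \<omega>" and l: "?w {..q - \<epsilon>} n \<omega> < p"
      using elim by (auto simp: z)
    define u where "u = ?w {..q} n \<omega>"
    define v where "v = ?w {..<q} n \<omega>"
    let ?f = "\<lambda>t. lorenz_objective X p t n \<omega>"
    obtain t where t: "Gn n \<omega> = ?f t"
      using ex_Gn_eq_objective[OF n] by blast
    \<comment> \<open>Outside the window the objective slopes down away from \<open>q\<close>, so a
      maximizer may be moved to the nearest end point without loss.\<close>
    have "\<exists>s\<in>{q - \<epsilon>..q + \<epsilon>}. ?f t \<le> ?f s"
    proof -
      consider "t > q + \<epsilon>" | "t < q - \<epsilon>" | "t \<in> {q - \<epsilon>..q + \<epsilon>}" by fastforce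
      then show ?thesis
      proof cases
        case 1
        then have "(t - (q + \<epsilon>)) * (p - ?w {..q + \<epsilon>} n \<omega>) \<le> 0"
          using r by (intro mult_nonneg_nonpos) auto
        then have "?f t \<le> ?f (q + \<epsilon>)"
          using lorenz_objective_le_supergradient[OF disjI1[OF refl], of X p t n \<omega> "q + \<epsilon>"] by linarith
        then show ?thesis using \<open>\<epsilon> > 0\<close> by (intro bexI[of _ "q + \<epsilon>"]) auto
      next
        case 2
        then have "(t - (q - \<epsilon>)) * (p - ?w {..q - \<epsilon>} n \<omega>) \<le> 0"
          using l by (intro mult_nonpos_nonneg) auto
        then have "?f t \<le> ?f (q - \<epsilon>)"
          using lorenz_objective_le_supergradient[OF disjI1[OF refl], of X p t n \<omega> "q - \<epsilon>"] by linarith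
        then show ?thesis using \<open>\<epsilon> > 0\<close> by (intro bexI[of _ "q - \<epsilon>"]) auto
      qed auto
    qed
    then obtain s where s: "q - \<epsilon> \<le> s" "s \<le> q + \<epsilon>" "?f t \<le> ?f s"
      by auto
    \<comment> \<open>Right of \<open>q\<close>, \<open>p \<le> a\<close> bounds the slope
      \<open>p - u\<close> by \<open>a - u\<close>; left of it, \<open>b \<le> p\<close> bounds
      \<open>v - p\<close> by \<open>v - b\<close>.\<close>
    have "?f s - ?f q \<le> \<epsilon> * (\<bar>u - a\<bar> + \<bar>v - b\<bar>)"
    proof (cases "q \<le> s")
      case True
      have "?f s - ?f q \<le> (s - q) * (p - u)"
        using lorenz_objective_le_supergradient[of "{..q}" q X p s n \<omega>] unfolding u_def by simp
      also have "\<dots> \<le> (s - q) * (\<bar>u - a\<bar> + \<bar>v - b\<bar>)"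
        using True a by (intro mult_left_mono) auto
      also have "\<dots> \<le> \<epsilon> * (\<bar>u - a\<bar> + \<bar>v - b\<bar>)"
        using s by (intro mult_right_mono) auto
      finally show ?thesis .
    next
      case False
      have "?f s - ?f q \<le> (s - q) * (p - v)"
        using lorenz_objective_le_supergradient[of "{..<q}" q X p s n \<omega>] unfolding v_def by simp
      also have "\<dots> = (q - s) * (v - p)"
        by (simp add: algebra_simps)
      also have "\<dots> \<le> (q - s) * (\<bar>u - a\<bar> + \<bar>v - b\<bar>)"
        using False b by (intro mult_left_mono) auto
      also have "\<dots> \<le> \<epsilon> * (\<bar>u - a\<bar> + \<bar>v - b\<bar>)"
        using s by (intro mult_right_mono) auto
      finally show ?thesis .
    qed
    then have upper: "Gn n \<omega> - ?f q \<le> \<epsilon> * (\<bar>u - a\<bar> + \<bar>v - b\<bar>)"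
      using s(3) t by linarith
    have lower: "0 \<le> Gn n \<omega> - ?f q"
      using objective_le_Gn[OF n] by simp
    have dev: "deviation {..q} n \<omega> = sqrt n * (u - a)" "deviation {..<q} n \<omega> = sqrt n * (v - b)"
      using n by (simp_all add: deviation_def u_def v_def a_def b_def sample_mean_def sum_subtractf diff_divide_distrib)
    have "\<bar>sqrt n * (Gn n \<omega> - ?f q)\<bar> = sqrt n * (Gn n \<omega> - ?f q)"
      using lower by simp
    also have "\<dots> \<le> sqrt n * (\<epsilon> * (\<bar>u - a\<bar> + \<bar>v - b\<bar>))"
      using upper by (intro mult_left_mono) auto
    also have "\<dots> = \<epsilon> * \<bar>\<bar>deviation {..q} n \<omega>\<bar> + \<bar>deviation {..<q} n \<omega>\<bar>\<bar>"
      unfolding dev abs_add_abs abs_mult by (simp add: distrib_left mult.left_commute)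
    finally show ?case by (simp add: z)
  qed
qed

lemma remainder_tendsto_0:
  assumes cont: "isCont (quantile D.C) p"
  shows "((\<lambda>(n, \<omega>). sqrt n * (Gn n \<omega> - lorenz_objective X p q n \<omega>)) \<longlongrightarrow> 0) whp"
proof (rule tendsto_whp_0_if_small_times_bounded)
  \<comment> \<open>At \<open>n = 0\<close>, which \<open>measurable_Gn\<close> excludes, the factor
    \<open>sqrt n\<close> makes the function zero.\<close>
  show "(\<lambda>\<omega>. sqrt n * (Gn n \<omega> - lorenz_objective X p q n \<omega>)) \<in> borel_measurable M" for n
    by (cases "n = 0") auto
  show "bounded_in_prob (\<lambda>n \<omega>. \<bar>deviation {..q} n \<omega>\<bar> + \<bar>deviation {..<q} n \<omega>\<bar>)"
    by (intro bounded_in_prob_add_abs bounded_in_prob_deviation measurable_deviation) auto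
qed (use remainder_le_deviation[OF cont] in auto)

section \<open>Linearization and asymptotic normality\<close>

text \<open>The linear term of the estimation error as a function of one observation. It equals
  minus the influence function, so both have the same second moment.\<close>

definition "score x = (p * q - max 0 (q - x) - G / expectation (X 0) * x) / expectation (X 0)"

lemma measurable_score [measurable]: "score \<in> borel_measurable borel"
  unfolding score_def[abs_def] by measurable

lemma lorenz_influence_eq_score:
  assumes "expectation (X 0) \<noteq> 0"
  shows "lorenz_influence D.C (expectation (X 0)) p (X 0) \<omega> = - score (X 0 \<omega>)"
proof -
  have "quantile D.C p = ereal q"
    using D.quantile_cdf[OF p] by (simp add: q_def)
  then have "lorenz_influence D.C (expectation (X 0)) p (X 0) \<omega>
     = 1 / expectation (X 0) * (max 0 (q - X 0 \<omega>) - expectation (\<lambda>\<omega>. max 0 (q - X 0 \<omega>)))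
       + G / expectation (X 0) / expectation (X 0) * (X 0 \<omega> - expectation (X 0))"
    unfolding lorenz_influence_def lorenz_curve_def G_def[symmetric]
    by (simp add: D.interval_integral_indicator_minus_cdf[OF integrable_D] integral_distr)
  also have "expectation (\<lambda>\<omega>. max 0 (q - X 0 \<omega>)) = p * q - G"
    by (simp add: G_eq h_def)
  finally show ?thesis
    using assms by (simp add: score_def right_diff_distrib diff_divide_distrib)
qed

lemma integrable_score: "integrable M (\<lambda>\<omega>. score (X 0 \<omega>))"
  unfolding score_def using integrable_X integrable_shortfall[of q] by simp

text \<open>The mean of \<open>p * q - max 0 (q - X 0 \<omega>)\<close> is \<open>h q = G\<close>,
  which cancels against the last term.\<close>

lemma expectation_score:
  assumes "expectation (X 0) \<noteq> 0"
  shows "expectation (\<lambda>\<omega>. score (X 0 \<omega>)) = 0"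
proof -
  have "expectation (\<lambda>\<omega>. score (X 0 \<omega>)) = (h q - G / expectation (X 0) * expectation (X 0)) / expectation (X 0)"
    unfolding score_def h_def using integrable_X integrable_shortfall[of q] by (simp add: prob_space)
  then show ?thesis
    using assms G_eq by simp
qed

lemma integrable_score_square:
  assumes sq: "integrable M (\<lambda>\<omega>. (X 0 \<omega>)\<^sup>2)"
  shows "integrable M (\<lambda>\<omega>. (score (X 0 \<omega>))\<^sup>2)"
proof (rule Bochner_Integration.integrable_bound)
  define m where "m = expectation (X 0)"
  \<comment> \<open>The score grows at most linearly: \<open>c + d * \<bar>x\<bar>\<close> dominates
    its absolute value.\<close>
  define c where "c = (\<bar>p * q\<bar> + \<bar>q\<bar>) / \<bar>m\<bar>"
  define d where "d = (1 + \<bar>G / m\<bar>) / \<bar>m\<bar>"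
  show "integrable M (\<lambda>\<omega>. 2 * c\<^sup>2 + 2 * d\<^sup>2 * (X 0 \<omega>)\<^sup>2)"
    using sq by simp
  have "(score x)\<^sup>2 \<le> 2 * c\<^sup>2 + 2 * d\<^sup>2 * x\<^sup>2" for x
  proof -
    have "0 \<le> max 0 (q - x)" "max 0 (q - x) \<le> \<bar>q\<bar> + \<bar>x\<bar>"
      by auto
    then have "\<bar>p * q - max 0 (q - x) - G / m * x\<bar> \<le> (\<bar>p * q\<bar> + \<bar>q\<bar>) + (\<bar>x\<bar> + \<bar>G / m * x\<bar>)"
      by linarith
    also have "\<dots> = (\<bar>p * q\<bar> + \<bar>q\<bar>) + (1 + \<bar>G / m\<bar>) * \<bar>x\<bar>"
      by (simp add: abs_mult distrib_right)
    finally have "\<bar>score x\<bar> \<le> ((\<bar>p * q\<bar> + \<bar>q\<bar>) + (1 + \<bar>G / m\<bar>) * \<bar>x\<bar>) / \<bar>m\<bar>"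
      unfolding score_def m_def[symmetric] abs_divide by (rule divide_right_mono) simp
    also have "\<dots> = c + d * \<bar>x\<bar>"
      by (simp only: c_def d_def add_divide_distrib[of "\<bar>p * q\<bar> + \<bar>q\<bar>"] times_divide_eq_left)
    finally have "\<bar>score x\<bar> \<le> c + d * \<bar>x\<bar>" .
    then have "(score x)\<^sup>2 \<le> (c + d * \<bar>x\<bar>)\<^sup>2"
      using power_mono[OF _ abs_ge_zero, of "score x" "c + d * \<bar>x\<bar>" 2] by simp
    also have "\<dots> \<le> 2 * c\<^sup>2 + 2 * (d * \<bar>x\<bar>)\<^sup>2"
      using sum_squares_bound[of c "d * \<bar>x\<bar>"] by (simp add: power2_sum)
    finally show ?thesis by (simp add: power_mult_distrib)
  qed
  then show "AE \<omega> in M. norm ((score (X 0 \<omega>))\<^sup>2) \<le> norm (2 * c\<^sup>2 + 2 * d\<^sup>2 * (X 0 \<omega>)\<^sup>2)"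
    by (auto intro!: AE_I2 order_trans[OF _ abs_ge_self])
qed measurable

text \<open>With \<open>S\<close> the scaled mean score and \<open>m\<close> the sample mean, the
  scaled error of the curve is \<open>\<mu> / m * S\<close> plus \<open>1 / m\<close> times the
  scaled gap between \<open>Gn\<close> and the objective at \<open>q\<close>. The factor
  \<open>\<mu> / m\<close> tends to 1 and \<open>S\<close> is bounded in probability.\<close>

lemma linearization_error_tendsto_0:
  assumes sq: "integrable M (\<lambda>\<omega>. (X 0 \<omega>)\<^sup>2)" and cont: "isCont (quantile D.C) p"
    and mean: "expectation (X 0) \<noteq> 0"
  shows "((\<lambda>(n, \<omega>). sqrt n * (empirical_lorenz_curve X p n \<omega> - lorenz_curve D.C (expectation (X 0)) p)
      - sqrt n * sample_mean (\<lambda>i \<omega>. score (X i \<omega>)) n \<omega>) \<longlongrightarrow> 0) whp"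
proof -
  define \<mu> where "\<mu> = expectation (X 0)"
  define S where "S n \<omega> = sqrt n * sample_mean (\<lambda>i \<omega>. score (X i \<omega>)) n \<omega>" for n \<omega>
  have "\<mu> \<noteq> 0" using mean by (simp add: \<mu>_def)
  have meanlim: "((\<lambda>(n, \<omega>). sample_mean X n \<omega>) \<longlongrightarrow> \<mu>) whp"
    unfolding \<mu>_def by (rule weak_law[OF integrable_X])
  have ratio: "((\<lambda>(n, \<omega>). \<mu> / sample_mean X n \<omega> - 1) \<longlongrightarrow> 0) whp"
    using tendsto_diff[OF tendsto_divide[OF tendsto_const meanlim \<open>\<mu> \<noteq> 0\<close>, of \<mu>] tendsto_const[of 1]] \<open>\<mu> \<noteq> 0\<close>
    by (simp add: case_prod_unfold)
  have [measurable]: "S n \<in> borel_measurable M" for n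
    unfolding S_def sample_mean_def by measurable
  have "bounded_in_prob S"
    unfolding S_def[abs_def]
    by (rule bounded_in_prob_compose) (use integrable_score_square[OF sq] expectation_score[OF mean] in auto)
  then have lim1: "((\<lambda>(n, \<omega>). (\<mu> / sample_mean X n \<omega> - 1) * S n \<omega>) \<longlongrightarrow> 0) whp"
  proof (rule tendsto_whp_0_if_small_times_bounded[rotated 2])
    fix \<epsilon> :: real assume "\<epsilon> > 0"
    from tendstoD[OF ratio this]
    show "\<forall>\<^sub>F (n, \<omega>) in whp. \<bar>(\<mu> / sample_mean X n \<omega> - 1) * S n \<omega>\<bar> \<le> \<epsilon> * \<bar>S n \<omega>\<bar>"
      by eventually_elim (auto simp: abs_mult intro!: mult_right_mono)
  qed measurable
  have lim2: "((\<lambda>(n, \<omega>). 1 / sample_mean X n \<omega> * (sqrt n * (Gn n \<omega> - lorenz_objective X p q n \<omega>))) \<longlongrightarrow> 0) whp"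
    using tendsto_mult[OF tendsto_divide[OF tendsto_const meanlim \<open>\<mu> \<noteq> 0\<close>, of 1] remainder_tendsto_0[OF cont]]
    by (simp add: case_prod_unfold)
  \<comment> \<open>The identity requires a nonzero sample mean, which holds with probability
    tending to 1.\<close>
  have "\<forall>\<^sub>F (n, \<omega>) in whp. sample_mean X n \<omega> \<noteq> 0"
    using tendsto_imp_eventually_ne[OF meanlim \<open>\<mu> \<noteq> 0\<close>] by (simp add: case_prod_unfold)
  then have "\<forall>\<^sub>F (n, \<omega>) in whp. (\<mu> / sample_mean X n \<omega> - 1) * S n \<omega>
        + 1 / sample_mean X n \<omega> * (sqrt n * (Gn n \<omega> - lorenz_objective X p q n \<omega>))
      = sqrt n * (empirical_lorenz_curve X p n \<omega> - lorenz_curve D.C \<mu> p) - S n \<omega>"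
    using eventually_whp_pos
  proof eventually_elim
    case (elim z)
    obtain n \<omega> where z: "z = (n, \<omega>)" by (cases z)
    define m where "m = sample_mean X n \<omega>"
    define s where "s = sample_mean (\<lambda>i \<omega>. score (X i \<omega>)) n \<omega>"
    have n: "n > 0" and m: "m \<noteq> 0"
      using elim by (auto simp: z m_def)
    have "\<mu> * s = lorenz_objective X p q n \<omega> - G / \<mu> * m"
    proof -
      have "\<mu> * score x = (p * q + (-1) * max 0 (q - x)) + (- (G / \<mu>)) * x" for x
        using \<open>\<mu> \<noteq> 0\<close> by (simp add: score_def \<mu>_def)
      then have "\<mu> * s = sample_mean (\<lambda>i \<omega>. (p * q + (-1) * max 0 (q - X i \<omega>)) + (- (G / \<mu>)) * X i \<omega>) n \<omega>"
        by (simp add: s_def sample_mean_def sum_distrib_left)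
      then show ?thesis
        unfolding sample_mean_add_cmult using n by (simp add: lorenz_objective_def m_def sample_mean_const)
    qed
    then have "lorenz_objective X p q n \<omega> = \<mu> * s + G / \<mu> * m"
      by simp
    then have "(\<mu> / m - 1) * s + 1 / m * (Gn n \<omega> - lorenz_objective X p q n \<omega>) = Gn n \<omega> / m - G / \<mu> - s"
      using m by (simp add: left_diff_distrib diff_divide_distrib add_divide_distrib)
    then have "sqrt n * ((\<mu> / m - 1) * s + 1 / m * (Gn n \<omega> - lorenz_objective X p q n \<omega>))
        = sqrt n * (Gn n \<omega> / m - G / \<mu> - s)"
      by simp
    then show ?case
      by (simp add: z S_def empirical_lorenz_curve_eq lorenz_curve_def G_def[symmetric] m_def[symmetric]
          s_def[symmetric] algebra_simps)
  qed
  then have "((\<lambda>(n, \<omega>). sqrt n * (empirical_lorenz_curve X p n \<omega> - lorenz_curve D.C \<mu> p) - S n \<omega>) \<longlongrightarrow> 0) whp"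
    using Lim_transform_eventually[OF tendsto_add[OF lim1 lim2]] by (simp add: case_prod_unfold)
  then show ?thesis
    by (simp add: S_def \<mu>_def)
qed

lemma empirical_lorenz_curve_converges_in_distribution:
  assumes sq: "integrable M (\<lambda>\<omega>. (X 0 \<omega>)\<^sup>2)" and cont: "isCont (quantile D.C) p"
    and mean: "expectation (X 0) \<noteq> 0"
  shows "converges_in_distribution M
    (\<lambda>n \<omega>. sqrt n * (empirical_lorenz_curve X p n \<omega> - lorenz_curve D.C (expectation (X 0)) p))
    (normal_law 0 (expectation (\<lambda>\<omega>. (score (X 0 \<omega>))\<^sup>2)))"
  unfolding converges_in_distribution_def
proof (intro conjI allI levy_continuity real_distribution_distr real_distribution_normal_law)
  let ?W = "\<lambda>n \<omega>. sqrt n * (empirical_lorenz_curve X p n \<omega> - lorenz_curve D.C (expectation (X 0)) p)"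
  let ?S = "\<lambda>n \<omega>. sqrt n * sample_mean (\<lambda>i \<omega>. score (X i \<omega>)) n \<omega>"
  interpret Z: iid_sequence M "\<lambda>i \<omega>. score (X i \<omega>)"
    by (rule iid_sequence_compose) measurable
  show W: "?W n \<in> borel_measurable M" for n
    by measurable
  then show "?W n \<in> borel_measurable M" for n .
  have S: "?S n \<in> borel_measurable M" for n
    by measurable
  fix t
  \<comment> \<open>The scaled error has the characteristic function of the scaled mean score up to
    a vanishing difference, so Levy's continuity theorem applies.\<close>
  have "(\<lambda>n. (char (distr M borel (?W n)) t - char (distr M borel (?S n)) t) + char (distr M borel (?S n)) t)
      \<longlonglongrightarrow> 0 + char (normal_law 0 (expectation (\<lambda>\<omega>. (score (X 0 \<omega>))\<^sup>2))) t"
  proof (rule tendsto_add)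
    show "(\<lambda>n. char (distr M borel (?W n)) t - char (distr M borel (?S n)) t) \<longlonglongrightarrow> 0"
      by (rule char_diff_tendsto_0[OF W S linearization_error_tendsto_0[OF assms]])
    show "(\<lambda>n. char (distr M borel (?S n)) t) \<longlonglongrightarrow> char (normal_law 0 (expectation (\<lambda>\<omega>. (score (X 0 \<omega>))\<^sup>2))) t"
      using Z.char_sqrt_sample_mean_tendsto[OF integrable_score_square[OF sq] expectation_score[OF mean]]
      by (subst char_normal_law) auto
  qed
  then show "(\<lambda>n. char (distr M borel (?W n)) t) \<longlonglongrightarrow> char (normal_law 0 (expectation (\<lambda>\<omega>. (score (X 0 \<omega>))\<^sup>2))) t"
    by simp
qed auto

end

theorem mainTheorem15:
  fixes M :: "'a measure" and X :: "nat \<Rightarrow> 'a \<Rightarrow> real" and F :: "real \<Rightarrow> real" and \<mu> p :: real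
  assumes "prob_space M"
    and "prob_space.indep_vars M (\<lambda>_. borel) X UNIV"
    and "\<And>n. distr M borel (X n) = distr M borel (X 0)"
    and "F = cdf (distr M borel (X 0))"
    and "integrable M (X 0)"
    and "\<mu> = (\<integral>\<omega>. X 0 \<omega> \<partial>M)"
    and "\<mu> \<noteq> 0"
    and "0 < p" and "p < 1"
  shows "converges_in_probability M (empirical_lorenz_curve X p) (\<lambda>_. lorenz_curve F \<mu> p)
    \<and> (integrable M (\<lambda>\<omega>. (X 0 \<omega>)\<^sup>2) \<and> isCont (quantile F) p \<longrightarrow>
         integrable M (lorenz_influence F \<mu> p (X 0))
       \<and> (\<integral>\<omega>. lorenz_influence F \<mu> p (X 0) \<omega> \<partial>M) = 0
       \<and> integrable M (\<lambda>\<omega>. (lorenz_influence F \<mu> p (X 0) \<omega>)\<^sup>2)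
       \<and> converges_in_distribution M
           (\<lambda>n \<omega>. sqrt (real n) * (empirical_lorenz_curve X p n \<omega> - lorenz_curve F \<mu> p))
           (normal_law 0 (\<integral>\<omega>. (lorenz_influence F \<mu> p (X 0) \<omega>)\<^sup>2 \<partial>M)))"
proof -
  interpret prob_space M by fact
  interpret lorenz_sample M X p
    by unfold_locales (rule assms)+
  note F = \<open>F = cdf (distr M borel (X 0))\<close> and \<mu> = \<open>\<mu> = (\<integral>\<omega>. X 0 \<omega> \<partial>M)\<close>
  have mean: "expectation (X 0) \<noteq> 0"
    using \<open>\<mu> \<noteq> 0\<close> unfolding \<mu> .
  \<comment> \<open>The sign disappears in the square, so the score and the influence function yield
    the same limiting variance.\<close>
  have influence: "lorenz_influence F \<mu> p (X 0) = (\<lambda>\<omega>. - score (X 0 \<omega>))"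
    unfolding F \<mu> by (rule ext) (rule lorenz_influence_eq_score[OF mean])
  show ?thesis
    unfolding influence
    using empirical_lorenz_curve_converges_in_probability[OF mean]
      empirical_lorenz_curve_converges_in_distribution[OF _ _ mean]
      integrable_score expectation_score[OF mean] integrable_score_square
    unfolding F \<mu> by simp
qed

end
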